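(* Let $L=E(4,4)$, $t\in\mathbb C$, $a,b,c\in\mathbb Z_{\ge0}$, and let $w$ be a singular vector in the Verma module $M_t(a,b,c)$. Then $w$ has degree at most $5$.
   Context: **The Lie superalgebra.** $L=E(4,4)$ has even part $W(4)$, the Lie algebra of formal vector fields $\sum_{i=1}^4P_i\partial_i$, $P_i\in\mathbb C[[x_1,\dots,x_4]]$, $\partial_i=\partial/\partial x_i$, and odd part $\Omega^1(4)$, the formal differential one-forms in $x_1,\dots,x_4$. Brackets: the usual one on $W(4)$; $[X,\omega]=L_X\omega-\frac12\mathrm{div}(X)\,\omega$ for $X$ a vector field and $\omega$ a one-form; $[\omega_1,\omega_2]=d\omega_1\wedge\omega_2+\omega_1\wedge d\omega_2$ for one-forms, where a three-form $\eta$ is identified with the vector field $X$ such that $\iota_X(dx_1\wedge dx_2\wedge dx_3\wedge dx_4)=\eta$. Write $d_i=dx_i$. The principal grading $L=\prod_{j\ge-1}L_j$ is given by $\deg x_i=1$, $\deg\partial_i=-1$, $\deg d=-2$ (so $\deg d_i=-1$). Put $L_{\ge0}=\prod_{j\ge0}L_j$, $L_{>0}=\prod_{j>0}L_j$. $L_{-1}$ is spanned by $\partial_1,\dots,\partial_4$ (even) and $d_1,\dots,d_4$ (odd), which supercommute. **The degree zero part.** $L_0$ is $\hat{\mathfrak p}(4)=\hat{\mathfrak p}(4)_{-2}\oplus\hat{\mathfrak p}(4)_{-1}\oplus\hat{\mathfrak p}(4)_{0}\oplus\hat{\mathfrak p}(4)_{1}$, where $\hat{\mathfrak p}(4)_1$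 is spanned by $b_{ij}=x_id_j+x_jd_i$, $\hat{\mathfrak p}(4)_0\cong\mathfrak{sl}_4$ by $x_i\partial_j$ ($i\neq j$) and $h_{ij}=x_i\partial_i-x_j\partial_j$, $\hat{\mathfrak p}(4)_{-1}$ by $a_{ij}=x_id_j-x_jd_i$, and $\hat{\mathfrak p}(4)_{-2}=\mathbb C C$ with $C=\sum_ix_i\partial_i$, central in $L_0$. **Modules.** Weights of $\mathfrak{sl}_4$ are written as the eigenvalues of $(h_{12},h_{23},h_{34})$; positive root vectors are $x_i\partial_j$, $i<j$. $F_t(a,b,c)$ is the irreducible module over $\mathfrak{gl}_4=\mathfrak{sl}_4\oplus\mathbb C C$ with highest weight $(a,b,c)$ on which $C$ acts by $t$, extended to $\mathfrak p^+=\hat{\mathfrak p}(4)_{-2}\oplus\hat{\mathfrak p}(4)_0\oplus\hat{\mathfrak p}(4)_1$ with $\hat{\mathfrak p}(4)_1$ acting by zero; $K_t(a,b,c)=U(\hat{\mathfrak p}(4))\otimes_{U(\mathfrak p^+)}F_t(a,b,c)$. $W_t(a,b,c)$ is the unique irreducible quotient of $K_t(a,b,c)$, except when $t\ne0$, $a=c=0$, $b\ge1$: for $t\neq0$ and $b\ge2$, $W_t(0,b,0)$ is the irreducible module which is a direct summand of both $K_t(0,b-1,0)$ and $K_t(0,b,0)$ (so $K_t(0,b,0)\cong W_t(0,b,0)\oplus W_t(0,b+1,0)$), and $K_t(0,1,0)=W_t(0,2,0)\oplus S$ where $S$ has a unique irreducible quotient, denoted $W_t(0,1,0)$. **Verma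 modules and singular vectors.** $M_t(a,b,c)=\mathrm{Ind}_{L_{\ge0}}^{L}W_t(a,b,c)$ with $L_{>0}$ acting trivially on $W_t(a,b,c)$; as a vector space it is $U(L_{-1})\otimes W_t(a,b,c)$. A vector in $L_{-1}^k\otimes W_t(a,b,c)$ has degree $k$. A non-zero $w\in M_t(a,b,c)$, homogeneous and an $\mathfrak{sl}_4$-weight vector, is singular if $(x_i\partial_{i+1})w=0$ for $i=1,2,3$, $bw=0$ for all $b\in\hat{\mathfrak p}(4)_1$, and $Xw=0$ for all $X\in L_{>0}$. *)

theory Defs
  imports "HOL-Analysis.Analysis" "HOL-Computational_Algebra.Formal_Power_Series"
    "HOL-Library.Poly_Mapping"
begin

section \<open>Complex vector spaces\<close>

class complex_vec = ab_group_add +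
  fixes scaleC :: "complex \<Rightarrow> 'a \<Rightarrow> 'a"  (infixr "*\<^sub>C" 75)
  assumes scaleC_add_right: "c *\<^sub>C (x + y) = c *\<^sub>C x + c *\<^sub>C y"
    and scaleC_add_left: "(c + d) *\<^sub>C x = c *\<^sub>C x + d *\<^sub>C x"
    and scaleC_scaleC: "c *\<^sub>C d *\<^sub>C x = (c * d) *\<^sub>C x"
    and scaleC_one: "1 *\<^sub>C x = x"

global_interpretation cvec: vector_space "scaleC :: complex \<Rightarrow> 'a \<Rightarrow> 'a::complex_vec"
  by unfold_locales (simp_all add: scaleC_add_right scaleC_add_left scaleC_scaleC scaleC_one)

instantiation complex :: complex_vec
begin
definition scaleC_complex :: "complex \<Rightarrow> complex \<Rightarrow> complex" where "scaleC_complex = (*)"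
instance by standard (simp_all add: scaleC_complex_def algebra_simps)
end

instantiation fps :: (complex_vec) complex_vec
begin
definition scaleC_fps :: "complex \<Rightarrow> 'a fps \<Rightarrow> 'a fps"
  where "c *\<^sub>C f = Abs_fps (\<lambda>n. c *\<^sub>C fps_nth f n)"
instance
  by standard (simp_all add: scaleC_fps_def fps_eq_iff scaleC_add_right scaleC_add_left
      scaleC_scaleC scaleC_one)
end

instantiation vec :: (complex_vec, finite) complex_vec
begin
definition scaleC_vec :: "complex \<Rightarrow> 'a ^ 'b \<Rightarrow> 'a ^ 'b"
  where "c *\<^sub>C v = (\<chi> i. c *\<^sub>C v $ i)"
instance
  by standard (simp_all add: scaleC_vec_def vec_eq_iff scaleC_add_right scaleC_add_left
      scaleC_scaleC scaleC_one)
end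

instantiation prod :: (complex_vec, complex_vec) complex_vec
begin
definition scaleC_prod :: "complex \<Rightarrow> 'a \<times> 'b \<Rightarrow> 'a \<times> 'b"
  where "c *\<^sub>C v = (c *\<^sub>C fst v, c *\<^sub>C snd v)"
instance
  by standard (simp_all add: scaleC_prod_def prod_eq_iff scaleC_add_right scaleC_add_left
      scaleC_scaleC scaleC_one)
end

instantiation poly_mapping :: (type, complex_vec) complex_vec
begin
lift_definition scaleC_poly_mapping :: "complex \<Rightarrow> ('a \<Rightarrow>\<^sub>0 'b) \<Rightarrow> 'a \<Rightarrow>\<^sub>0 'b"
  is "\<lambda>c f k. c *\<^sub>C f k"
proof -
  fix c :: complex and f :: "'a \<Rightarrow> 'b"
  assume "finite {k. f k \<noteq> 0}"
  then show "finite {k. c *\<^sub>C f k \<noteq> 0}"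
    by (rule rev_finite_subset) auto
qed
instance
  by standard (transfer; simp add: fun_eq_iff scaleC_add_right scaleC_add_left
      scaleC_scaleC scaleC_one)+
end


section \<open>The Lie superalgebra \<open>E(4,4)\<close>\<close>

text \<open>Power series in four variables are iterated power series; \<open>x\<^sub>1\<close> is the innermost
  variable, \<open>x\<^sub>4\<close> the outermost.  Indices \<open>1, 2, 3, 4\<close> live in the type \<open>4\<close>, in which
  \<open>4 = 0\<close>; the order of that type is therefore never used.\<close>

type_synonym pseries = "complex fps fps fps fps"

definition coeff4 :: "pseries \<Rightarrow> nat ^ 4 \<Rightarrow> complex" where
  "coeff4 f m = fps_nth (fps_nth (fps_nth (fps_nth f (m $ 4)) (m $ 3)) (m $ 2)) (m $ 1)"

definition xvar :: "4 \<Rightarrow> pseries" where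
  "xvar i =
    (if i = 1 then fps_const (fps_const (fps_const fps_X))
     else if i = 2 then fps_const (fps_const fps_X)
     else if i = 3 then fps_const fps_X
     else fps_X)"

definition fps_coeffwise :: "('a \<Rightarrow> 'b) \<Rightarrow> 'a fps \<Rightarrow> 'b fps" where
  "fps_coeffwise g f = Abs_fps (\<lambda>n. g (fps_nth f n))"

definition pdiff :: "4 \<Rightarrow> pseries \<Rightarrow> pseries" where
  "pdiff i =
    (if i = 1 then fps_coeffwise (fps_coeffwise (fps_coeffwise fps_deriv))
     else if i = 2 then fps_coeffwise (fps_coeffwise fps_deriv)
     else if i = 3 then fps_coeffwise fps_deriv
     else fps_deriv)"

text \<open>\<open>(X, \<omega>)\<close> stands for \<open>\<Sum>\<^sub>i X\<^sub>i \<partial>\<^sub>i + \<Sum>\<^sub>i \<omega>\<^sub>i dx\<^sub>i\<close>, the sum of the even element \<open>X\<close> and the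
  odd element \<open>\<omega>\<close>.\<close>

type_synonym e44 = "(pseries ^ 4) \<times> (pseries ^ 4)"

definition vfield :: "pseries \<Rightarrow> 4 \<Rightarrow> e44" where  \<comment> \<open>\<open>P \<partial>\<^sub>i\<close>\<close>
  "vfield P i = (axis i P, 0)"

definition oneform :: "pseries \<Rightarrow> 4 \<Rightarrow> e44" where  \<comment> \<open>\<open>P dx\<^sub>i\<close>\<close>
  "oneform P i = (0, axis i P)"

definition vf_bracket :: "pseries ^ 4 \<Rightarrow> pseries ^ 4 \<Rightarrow> pseries ^ 4" where
  "vf_bracket X Y = (\<chi> j. \<Sum>i\<in>UNIV. X $ i * pdiff i (Y $ j) - Y $ i * pdiff i (X $ j))"

definition divergence :: "pseries ^ 4 \<Rightarrow> pseries" where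
  "divergence X = (\<Sum>i\<in>UNIV. pdiff i (X $ i))"

definition lie_derivative :: "pseries ^ 4 \<Rightarrow> pseries ^ 4 \<Rightarrow> pseries ^ 4" where
  "lie_derivative X \<omega> = (\<chi> j. \<Sum>i\<in>UNIV. X $ i * pdiff i (\<omega> $ j) + \<omega> $ i * pdiff j (X $ i))"

definition vf_on_form :: "pseries ^ 4 \<Rightarrow> pseries ^ 4 \<Rightarrow> pseries ^ 4" where
  "vf_on_form X \<omega> = (\<chi> j. lie_derivative X \<omega> $ j - (1/2) *\<^sub>C (divergence X * \<omega> $ j))"

text \<open>Two-forms and three-forms are given by their alternating coefficient families, that is,
  \<open>\<eta> = \<Sum>\<^bsub>j<k<l\<^esub> \<eta>\<^sub>j\<^sub>k\<^sub>l dx\<^sub>j \<and> dx\<^sub>k \<and> dx\<^sub>l\<close>.\<close>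

definition ext_deriv :: "pseries ^ 4 \<Rightarrow> 4 \<Rightarrow> 4 \<Rightarrow> pseries" where
  "ext_deriv \<omega> j k = pdiff j (\<omega> $ k) - pdiff k (\<omega> $ j)"

definition wedge21 :: "(4 \<Rightarrow> 4 \<Rightarrow> pseries) \<Rightarrow> pseries ^ 4 \<Rightarrow> 4 \<Rightarrow> 4 \<Rightarrow> 4 \<Rightarrow> pseries" where
  "wedge21 \<beta> \<omega> j k l = \<beta> j k * \<omega> $ l + \<beta> k l * \<omega> $ j + \<beta> l j * \<omega> $ k"

text \<open>The inverse of \<open>X \<mapsto> \<iota>\<^sub>X (dx\<^sub>1 \<and> dx\<^sub>2 \<and> dx\<^sub>3 \<and> dx\<^sub>4)
  = X\<^sub>1 dx\<^sub>2 \<and> dx\<^sub>3 \<and> dx\<^sub>4 - X\<^sub>2 dx\<^sub>1 \<and> dx\<^sub>3 \<and> dx\<^sub>4 + X\<^sub>3 dx\<^sub>1 \<and> dx\<^sub>2 \<and> dx\<^sub>4 - X\<^sub>4 dx\<^sub>1 \<and> dx\<^sub>2 \<and> dx\<^sub>3\<close>.\<close>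

definition vf_of_three_form :: "(4 \<Rightarrow> 4 \<Rightarrow> 4 \<Rightarrow> pseries) \<Rightarrow> pseries ^ 4" where
  "vf_of_three_form \<eta> =
    (\<chi> i. if i = 1 then \<eta> 2 3 4 else if i = 2 then - \<eta> 1 3 4
          else if i = 3 then \<eta> 1 2 4 else - \<eta> 1 2 3)"

text \<open>\<open>\<omega>\<^sub>1 \<and> d\<omega>\<^sub>2 = d\<omega>\<^sub>2 \<and> \<omega>\<^sub>1\<close>, since \<open>d\<omega>\<^sub>2\<close> is a two-form.\<close>

definition form_bracket :: "pseries ^ 4 \<Rightarrow> pseries ^ 4 \<Rightarrow> pseries ^ 4" where
  "form_bracket \<omega> \<tau> = vf_of_three_form
     (\<lambda>j k l. wedge21 (ext_deriv \<omega>) \<tau> j k l + wedge21 (ext_deriv \<tau>) \<omega> j k l)"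

fun lie :: "e44 \<Rightarrow> e44 \<Rightarrow> e44" where
  "lie (X, \<omega>) (Y, \<tau>) =
     (vf_bracket X Y + form_bracket \<omega> \<tau>, vf_on_form X \<tau> - vf_on_form Y \<omega>)"

text \<open>Parities are elements of the type \<open>2\<close> of integers modulo 2.\<close>

definition e44_part :: "2 \<Rightarrow> e44 set" where
  "e44_part p = (if p = 0 then {x. snd x = 0} else {x. fst x = 0})"

definition super_sign :: "2 \<Rightarrow> 2 \<Rightarrow> complex" where
  "super_sign p q = (if p = 1 \<and> q = 1 then -1 else 1)"

text \<open>In the principal grading \<open>P \<partial>\<^sub>i\<close> and \<open>P dx\<^sub>i\<close> both have degree \<open>j\<close> if \<open>P\<close> is homogeneous of
  degree \<open>j + 1\<close>.\<close>

definition L_deg :: "int \<Rightarrow> e44 set" where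
  "L_deg j = {(X, \<omega>). \<forall>i m. coeff4 (X $ i) m \<noteq> 0 \<or> coeff4 (\<omega> $ i) m \<noteq> 0
                 \<longrightarrow> int (\<Sum>k\<in>UNIV. m $ k) = j + 1}"

definition L_ge :: "int \<Rightarrow> e44 set" where
  "L_ge j = {(X, \<omega>). \<forall>i m. coeff4 (X $ i) m \<noteq> 0 \<or> coeff4 (\<omega> $ i) m \<noteq> 0
                 \<longrightarrow> int (\<Sum>k\<in>UNIV. m $ k) \<ge> j + 1}"

definition C_elt :: e44 where
  "C_elt = (\<Sum>i\<in>UNIV. vfield (xvar i) i)"

definition h_elt :: "4 \<Rightarrow> 4 \<Rightarrow> e44" where
  "h_elt i j = vfield (xvar i) i - vfield (xvar j) j"

definition b_elt :: "4 \<Rightarrow> 4 \<Rightarrow> e44" where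
  "b_elt i j = oneform (xvar i) j + oneform (xvar j) i"

definition p4_1 :: "e44 set" where
  "p4_1 = cvec.span {b_elt i j | i j. True}"

definition sl4 :: "e44 set" where
  "sl4 = cvec.span ({vfield (xvar i) j | i j. i \<noteq> j} \<union> {h_elt i j | i j. True})"

definition gl4 :: "e44 set" where
  "gl4 = cvec.span (sl4 \<union> {C_elt})"

definition p_plus :: "e44 set" where
  "p_plus = cvec.span (gl4 \<union> p4_1)"


section \<open>Supermodules\<close>

text \<open>Modules are represented as subquotients, so that quotients need no new type: a record
  \<open>V\<close> stands for the superspace \<open>carrier_sp V / null_sp V\<close>, whose homogeneous parts are the images
  of \<open>part V 0\<close> and \<open>part V 1\<close>.  Equality in the module is congruence modulo \<open>null_sp V\<close>.  A
  module in the ordinary sense has \<open>null_sp V = {0}\<close>.\<close>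

record 'v supermod =
  part :: "2 \<Rightarrow> 'v set"
  null_sp :: "'v set"
  act :: "e44 \<Rightarrow> 'v \<Rightarrow> 'v"

definition carrier_sp :: "('v::complex_vec) supermod \<Rightarrow> 'v set" where
  "carrier_sp V = {u + v | u v. u \<in> part V 0 \<and> v \<in> part V 1}"

definition eq_in :: "('v::complex_vec) supermod \<Rightarrow> 'v \<Rightarrow> 'v \<Rightarrow> bool" where
  "eq_in V u v \<longleftrightarrow> u - v \<in> null_sp V"

text \<open>For \<open>U = null_sp V\<close> this also says that the parts of the quotient intersect in \<open>0\<close>.\<close>

definition graded_in :: "('v::complex_vec) supermod \<Rightarrow> 'v set \<Rightarrow> bool" where
  "graded_in V U \<longleftrightarrow> (\<forall>u\<in>part V 0. \<forall>v\<in>part V 1. u + v \<in> U \<longrightarrow> u \<in> U \<and> v \<in> U)"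

definition supermodule :: "e44 set \<Rightarrow> ('v::complex_vec) supermod \<Rightarrow> bool" where
  "supermodule S V \<longleftrightarrow>
     (\<forall>p. cvec.subspace (part V p)) \<and>
     cvec.subspace (null_sp V) \<and> null_sp V \<subseteq> carrier_sp V \<and> graded_in V (null_sp V) \<and>
     (\<forall>x\<in>S. \<forall>v\<in>null_sp V. act V x v \<in> null_sp V) \<and>
     (\<forall>x\<in>S. \<forall>v\<in>carrier_sp V. act V x v \<in> carrier_sp V) \<and>
     (\<forall>p q. \<forall>x\<in>S \<inter> e44_part p. \<forall>v\<in>part V q. act V x v \<in> part V (p + q)) \<and>
     (\<forall>c. \<forall>x\<in>S. \<forall>u\<in>carrier_sp V. \<forall>v\<in>carrier_sp V.
        eq_in V (act V x (c *\<^sub>C u + v)) (c *\<^sub>C act V x u + act V x v)) \<and>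
     (\<forall>c. \<forall>x\<in>S. \<forall>y\<in>S. \<forall>v\<in>carrier_sp V.
        eq_in V (act V (c *\<^sub>C x + y) v) (c *\<^sub>C act V x v + act V y v)) \<and>
     (\<forall>p q. \<forall>x\<in>S \<inter> e44_part p. \<forall>y\<in>S \<inter> e44_part q. \<forall>v\<in>carrier_sp V.
        eq_in V (act V (lie x y) v)
          (act V x (act V y v) - super_sign p q *\<^sub>C act V y (act V x v)))"

definition submod :: "e44 set \<Rightarrow> ('v::complex_vec) supermod \<Rightarrow> 'v set \<Rightarrow> bool" where
  "submod S V U \<longleftrightarrow>
     cvec.subspace U \<and> null_sp V \<subseteq> U \<and> U \<subseteq> carrier_sp V \<and> graded_in V U \<and>
     (\<forall>x\<in>S. \<forall>u\<in>U. act V x u \<in> U)"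

definition restrict_mod :: "('v::complex_vec) supermod \<Rightarrow> 'v set \<Rightarrow> 'v supermod" where
  "restrict_mod V U = V\<lparr>part := (\<lambda>p. part V p \<inter> U)\<rparr>"

definition irreducible_mod :: "e44 set \<Rightarrow> ('v::complex_vec) supermod \<Rightarrow> bool" where
  "irreducible_mod S V \<longleftrightarrow>
     supermodule S V \<and> carrier_sp V \<noteq> null_sp V \<and>
     (\<forall>U. submod S V U \<longrightarrow> U = null_sp V \<or> U = carrier_sp V)"

text \<open>A homomorphism preserves or reverses parity.  One that reverses parity commutes with odd
  elements here; composing it with \<open>v \<mapsto> (-1)\<^sup>p v\<close> on the part of parity \<open>p\<close> gives an odd
  homomorphism in the sense of the sign rule.\<close>

definition mod_hom ::
  "e44 set \<Rightarrow> ('v::complex_vec) supermod \<Rightarrow> ('w::complex_vec) supermod \<Rightarrow> ('v \<Rightarrow> 'w) \<Rightarrow> bool"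
where
  "mod_hom S V W \<phi> \<longleftrightarrow>
     Vector_Spaces.linear scaleC scaleC \<phi> \<and>
     (\<exists>p. \<forall>q. \<phi> ` part V q \<subseteq> part W (p + q)) \<and>
     \<phi> ` null_sp V \<subseteq> null_sp W \<and>
     (\<forall>x\<in>S. \<forall>v\<in>carrier_sp V. eq_in W (\<phi> (act V x v)) (act W x (\<phi> v)))"

definition surj_hom ::
  "e44 set \<Rightarrow> ('v::complex_vec) supermod \<Rightarrow> ('w::complex_vec) supermod \<Rightarrow> ('v \<Rightarrow> 'w) \<Rightarrow> bool"
where
  "surj_hom S V W \<phi> \<longleftrightarrow>
     mod_hom S V W \<phi> \<and> (\<forall>w\<in>carrier_sp W. \<exists>v\<in>carrier_sp V. eq_in W (\<phi> v) w)"

definition isomorphic_mod ::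
  "e44 set \<Rightarrow> ('v::complex_vec) supermod \<Rightarrow> ('w::complex_vec) supermod \<Rightarrow> bool" where
  "isomorphic_mod S V W \<longleftrightarrow>
     (\<exists>\<phi>. surj_hom S V W \<phi> \<and> (\<forall>v\<in>carrier_sp V. \<phi> v \<in> null_sp W \<longrightarrow> v \<in> null_sp V))"

definition irreducible_quotient ::
  "e44 set \<Rightarrow> ('v::complex_vec) supermod \<Rightarrow> ('w::complex_vec) supermod \<Rightarrow> bool" where
  "irreducible_quotient S V W \<longleftrightarrow> irreducible_mod S W \<and> (\<exists>\<phi>. surj_hom S V W \<phi>)"

definition direct_sum_mod ::
  "e44 set \<Rightarrow> ('v::complex_vec) supermod \<Rightarrow> 'v set \<Rightarrow> 'v set \<Rightarrow> bool" where
  "direct_sum_mod S V A B \<longleftrightarrow>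
     submod S V A \<and> submod S V B \<and> A \<inter> B = null_sp V \<and>
     carrier_sp V = {u + v | u v. u \<in> A \<and> v \<in> B}"

definition direct_summand ::
  "e44 set \<Rightarrow> ('w::complex_vec) supermod \<Rightarrow> ('v::complex_vec) supermod \<Rightarrow> bool" where
  "direct_summand S W V \<longleftrightarrow>
     (\<exists>A B. direct_sum_mod S V A B \<and> isomorphic_mod S W (restrict_mod V A))"


section \<open>Induced modules\<close>

text \<open>\<open>Ind S T V\<close> is \<open>U(S) \<otimes>\<^bsub>U(T)\<^esub> V\<close>, for subalgebras \<open>T \<subseteq> S\<close> and a \<open>T\<close>-module \<open>V\<close>.  It is
  written out as the space spanned by the symbols \<open>x\<^sub>1 \<cdots> x\<^sub>n \<otimes> v\<close> modulo the relations that make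
  these symbols multilinear, the defining relations of the enveloping algebra of \<open>S\<close>, and
  balancedness over \<open>T\<close>.\<close>

definition tens :: "e44 list \<Rightarrow> 'v \<Rightarrow> (e44 list \<times> 'v) \<Rightarrow>\<^sub>0 complex" where
  "tens xs v = Poly_Mapping.single (xs, v) 1"

inductive_set ind_rel ::
  "e44 set \<Rightarrow> e44 set \<Rightarrow> ('v::complex_vec) supermod \<Rightarrow> ((e44 list \<times> 'v) \<Rightarrow>\<^sub>0 complex) set"
  for S T V
where
  lin_alg: "\<lbrakk>xs \<in> lists S; ys \<in> lists S; x \<in> S; y \<in> S; v \<in> carrier_sp V\<rbrakk> \<Longrightarrow>
    tens (xs @ (c *\<^sub>C x + y) # ys) v - c *\<^sub>C tens (xs @ x # ys) v - tens (xs @ y # ys) v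
      \<in> ind_rel S T V"
| lin_mod: "\<lbrakk>xs \<in> lists S; u \<in> carrier_sp V; v \<in> carrier_sp V\<rbrakk> \<Longrightarrow>
    tens xs (c *\<^sub>C u + v) - c *\<^sub>C tens xs u - tens xs v \<in> ind_rel S T V"
| null_mod: "\<lbrakk>xs \<in> lists S; v \<in> null_sp V\<rbrakk> \<Longrightarrow> tens xs v \<in> ind_rel S T V"
| envelop: "\<lbrakk>xs \<in> lists S; ys \<in> lists S; x \<in> S \<inter> e44_part p; y \<in> S \<inter> e44_part q;
      v \<in> carrier_sp V\<rbrakk> \<Longrightarrow>
    tens (xs @ x # y # ys) v - super_sign p q *\<^sub>C tens (xs @ y # x # ys) v
      - tens (xs @ lie x y # ys) v \<in> ind_rel S T V"
| balanced: "\<lbrakk>xs \<in> lists S; x \<in> T; v \<in> carrier_sp V\<rbrakk> \<Longrightarrow>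
    tens (xs @ [x]) v - tens xs (act V x v) \<in> ind_rel S T V"

inductive tens_parity ::
  "e44 set \<Rightarrow> ('v::complex_vec) supermod \<Rightarrow> 2 \<Rightarrow> e44 list \<Rightarrow> 'v \<Rightarrow> bool" for S V
where
  base: "v \<in> part V p \<Longrightarrow> tens_parity S V p [] v"
| step: "x \<in> S \<inter> e44_part q \<Longrightarrow> tens_parity S V p xs v \<Longrightarrow> tens_parity S V (q + p) (x # xs) v"

definition Ind ::
  "e44 set \<Rightarrow> e44 set \<Rightarrow> ('v::complex_vec) supermod \<Rightarrow> ((e44 list \<times> 'v) \<Rightarrow>\<^sub>0 complex) supermod"
where
  "Ind S T V = \<lparr>
     part = (\<lambda>p. cvec.span ({tens xs v | xs v. tens_parity S V p xs v} \<union> ind_rel S T V)),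
     null_sp = cvec.span (ind_rel S T V),
     act = (\<lambda>x f. \<Sum>(xs, v)\<in>Poly_Mapping.keys f.
              Poly_Mapping.lookup f (xs, v) *\<^sub>C tens (x # xs) v) \<rparr>"


section \<open>The modules \<open>F\<close>, \<open>K\<close>, \<open>W\<close> and the Verma modules\<close>

definition highest_weight_vector ::
  "nat \<Rightarrow> nat \<Rightarrow> nat \<Rightarrow> ('v::complex_vec) supermod \<Rightarrow> 'v \<Rightarrow> bool" where
  "highest_weight_vector a b c V v \<longleftrightarrow>
     v \<in> carrier_sp V \<and> v \<notin> null_sp V \<and>
     eq_in V (act V (h_elt 1 2) v) (of_nat a *\<^sub>C v) \<and>
     eq_in V (act V (h_elt 2 3) v) (of_nat b *\<^sub>C v) \<and>
     eq_in V (act V (h_elt 3 4) v) (of_nat c *\<^sub>C v) \<and>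
     (\<forall>(i, j)\<in>{(1,2), (1,3), (1,4), (2,3), (2,4), (3,4)}.
        act V (vfield (xvar i) j) v \<in> null_sp V)"

definition is_F :: "complex \<Rightarrow> nat \<Rightarrow> nat \<Rightarrow> nat \<Rightarrow> ('v::complex_vec) supermod \<Rightarrow> bool" where
  "is_F t a b c F \<longleftrightarrow>
     supermodule p_plus F \<and> irreducible_mod gl4 F \<and>
     (\<exists>v. highest_weight_vector a b c F v) \<and>
     (\<forall>v\<in>carrier_sp F. eq_in F (act F C_elt v) (t *\<^sub>C v)) \<and>
     (\<forall>x\<in>p4_1. \<forall>v\<in>carrier_sp F. act F x v \<in> null_sp F)"

definition K_mod :: "('v::complex_vec) supermod \<Rightarrow> ((e44 list \<times> 'v) \<Rightarrow>\<^sub>0 complex) supermod" where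
  "K_mod F = Ind (L_deg 0) p_plus F"

text \<open>A module is an instance of \<open>W\<^sub>t(a,b,c)\<close> only up to isomorphism.  The modules \<open>F\<close> are taken
  on the space of finitely supported sequences, into which every finite-dimensional space embeds.
  All modules here are over \<open>L_deg 0\<close>, the degree zero part of \<open>E(4,4)\<close>.\<close>

type_synonym seq = "nat \<Rightarrow>\<^sub>0 complex"

definition is_W_generic :: "complex \<Rightarrow> nat \<Rightarrow> nat \<Rightarrow> nat \<Rightarrow> ('w::complex_vec) supermod \<Rightarrow> bool" where
  "is_W_generic t a b c W \<longleftrightarrow>
     (\<exists>F :: seq supermod. is_F t a b c F \<and> irreducible_quotient (L_deg 0) (K_mod F) W)"

text \<open>\<open>W\<^sub>t(0,b,0)\<close> for \<open>t \<noteq> 0\<close> and \<open>b \<ge> 2\<close>.\<close>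

definition is_W_middle :: "complex \<Rightarrow> nat \<Rightarrow> ('w::complex_vec) supermod \<Rightarrow> bool" where
  "is_W_middle t b W \<longleftrightarrow>
     irreducible_mod (L_deg 0) W \<and>
     (\<exists>(F :: seq supermod) (F' :: seq supermod). is_F t 0 (b - 1) 0 F \<and> is_F t 0 b 0 F' \<and>
        direct_summand (L_deg 0) W (K_mod F) \<and> direct_summand (L_deg 0) W (K_mod F'))"

text \<open>\<open>W\<^sub>t(0,1,0)\<close> for \<open>t \<noteq> 0\<close>: the irreducible quotient of a complement \<open>B\<close> of \<open>W\<^sub>t(0,2,0)\<close>.\<close>

definition is_W_one :: "complex \<Rightarrow> ('w::complex_vec) supermod \<Rightarrow> bool" where
  "is_W_one t W \<longleftrightarrow>
     (\<exists>(F :: seq supermod) A B. is_F t 0 1 0 F \<and>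
        direct_sum_mod (L_deg 0) (K_mod F) A B \<and>
        is_W_middle t 2 (restrict_mod (K_mod F) A) \<and>
        irreducible_quotient (L_deg 0) (restrict_mod (K_mod F) B) W)"

definition is_W :: "complex \<Rightarrow> nat \<Rightarrow> nat \<Rightarrow> nat \<Rightarrow> ('w::complex_vec) supermod \<Rightarrow> bool" where
  "is_W t a b c W \<longleftrightarrow>
     (if t \<noteq> 0 \<and> a = 0 \<and> c = 0 \<and> b \<ge> 1
      then (if b \<ge> 2 then is_W_middle t b W else is_W_one t W)
      else is_W_generic t a b c W)"

definition L_pos_trivial :: "('w::complex_vec) supermod \<Rightarrow> bool" where
  "L_pos_trivial W \<longleftrightarrow>
     supermodule (L_ge 0) W \<and> (\<forall>x\<in>L_ge 1. \<forall>v\<in>carrier_sp W. act W x v \<in> null_sp W)"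

definition Verma :: "('w::complex_vec) supermod \<Rightarrow> ((e44 list \<times> 'w) \<Rightarrow>\<^sub>0 complex) supermod" where
  "Verma W = Ind UNIV (L_ge 0) W"

text \<open>The degree \<open>k\<close> part \<open>L\<^sub>-\<^sub>1\<^sup>k \<otimes> W\<close>.\<close>

definition Verma_degree ::
  "('w::complex_vec) supermod \<Rightarrow> nat \<Rightarrow> ((e44 list \<times> 'w) \<Rightarrow>\<^sub>0 complex) set" where
  "Verma_degree W k =
     {w. \<exists>u\<in>cvec.span {tens xs v | xs v.
              xs \<in> lists (L_deg (-1)) \<and> length xs = k \<and> v \<in> carrier_sp W}.
           eq_in (Verma W) w u}"

definition weight_vector :: "('v::complex_vec) supermod \<Rightarrow> 'v \<Rightarrow> bool" where
  "weight_vector V v \<longleftrightarrow>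
     (\<forall>(i, j)\<in>{(1,2), (2,3), (3,4)}. \<exists>l. eq_in V (act V (h_elt i j) v) (l *\<^sub>C v))"

definition singular_of_degree ::
  "('w::complex_vec) supermod \<Rightarrow> nat \<Rightarrow> ((e44 list \<times> 'w) \<Rightarrow>\<^sub>0 complex) \<Rightarrow> bool" where
  "singular_of_degree W k w \<longleftrightarrow>
     w \<in> Verma_degree W k \<and> w \<notin> null_sp (Verma W) \<and> weight_vector (Verma W) w \<and>
     (\<forall>(i, j)\<in>{(1,2), (2,3), (3,4)}. act (Verma W) (vfield (xvar i) j) w \<in> null_sp (Verma W)) \<and>
     (\<forall>x\<in>p4_1. act (Verma W) x w \<in> null_sp (Verma W)) \<and>
     (\<forall>x\<in>L_ge 1. act (Verma W) x w \<in> null_sp (Verma W))"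

end

(*
  Restricted to W(4), the Verma module is induced from Lambda(d_1,...,d_4) (x) W, and vector fields
  never increase the number of factors d_j.  Let u be singular of degree k >= 6.  By downward
  induction on i, its components with i factors d_j vanish: suppose this holds for more factors.
  The components with i factors form a polynomial of degree m = k - i in the partial derivatives;
  let N_gamma be its coefficient at partial^gamma.  As there are only four d_j, m >= 2.  Put
  E = x_1 partial_1.  If N_delta = 0 whenever delta_1 > gamma_1, then x^(gamma+e_1) partial_1 u = 0
  gives E N_gamma = 0, and x^gamma partial_1 u = 0 gives N_gamma = gamma_1 E N_gamma (here
  |gamma| = m >= 2 is needed), so N_gamma = 0.

  That u has well-defined coefficients is a Poincare-Birkhoff-Witt theorem, proved on the dual
  side: linear functions of words in the generators of L_{-1} that are supersymmetric in the
  letters carry a right action of L, and so pair with the induced module.  Letting such functions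
  take values in the Verma module itself, one of them is the identity, so the pairing separates
  points.
*)
theory Submission
  imports Defs
begin

subsection \<open>Calculus of power series in four variables\<close>

text \<open>Why vector fields do not increase the number of factors d_j: [X, d_j] is a one-form, so
  moving X past d_j removes that factor, and the one-form either ends as a single letter d_l or
  meets another factor and becomes a vector field again. Why the inner induction is ordered by the
  exponent of partial_1: in the component of x^(gamma+e_1) partial_1 u without partial derivatives,
  partial^delta with |delta| = m contributes only if delta = gamma + e_1 - e_l, and then through x_l
  partial_1. For l \<noteq> 1 the exponent delta_1 is gamma_1 + 1, so N_delta is already known to
  vanish; l = 1 leaves E. The field x^gamma partial_1 has degree m - 1, which is where m >= 2
  enters. The obstacle is that the induced module is a quotient by relations in which no word is
  visibly non-zero. On the dual side L acts by an explicit recursion on words, and the law of a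
  right action is checked letter by letter: each letter uses the Jacobi identity with one argument
  in L_{-1}, the empty word uses the module law of W.\<close>

lemma fps_coeffwise_nth [simp]: "fps_nth (fps_coeffwise g f) n = g (fps_nth f n)"
  by (simp add: fps_coeffwise_def)

definition derivation :: "('a::comm_ring_1 \<Rightarrow> 'a) \<Rightarrow> bool" where
  "derivation D \<longleftrightarrow> (\<forall>f g. D (f + g) = D f + D g) \<and> (\<forall>f g. D (f * g) = f * D g + D f * g)"

lemma derivation_fps_deriv: "derivation (fps_deriv :: 'a::comm_ring_1 fps \<Rightarrow> _)"
  by (simp add: derivation_def)

text \<open>Coefficients of a product are finite sums of products, so the Leibniz rule lifts through
  one level of power series; iterating this reaches the inner variables.\<close>

lemma derivation_fps_coeffwise:
  assumes "derivation D"
  shows "derivation (fps_coeffwise D)"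
proof -
  have add: "D (f + g) = D f + D g" and mult: "D (f * g) = f * D g + D f * g" for f g
    using assms by (auto simp: derivation_def)
  have "D 0 = 0" using add[of 0 0] by simp
  then have sum: "D (sum h A) = (\<Sum>i\<in>A. D (h i))" for h :: "nat \<Rightarrow> _" and A
    by (induction A rule: infinite_finite_induct) (simp_all add: add)
  show ?thesis
    by (simp add: derivation_def fps_eq_iff add sum mult fps_mult_nth sum.distrib)
qed

lemma derivation_pdiff: "derivation (pdiff i)"
  by (simp add: pdiff_def derivation_fps_coeffwise derivation_fps_deriv)

lemma pdiff_add [simp]: "pdiff i (f + g) = pdiff i f + pdiff i g"
  and pdiff_mult [simp]: "pdiff i (f * g) = f * pdiff i g + pdiff i f * g"
  using derivation_pdiff[of i] by (auto simp: derivation_def)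

lemma pdiff_0 [simp]: "pdiff i 0 = 0"
  using pdiff_add[of i 0 0] by simp

lemma pdiff_1 [simp]: "pdiff i 1 = 0"
  using pdiff_mult[of i 1 1] by simp

lemma pdiff_minus [simp]: "pdiff i (- f) = - pdiff i f"
  using pdiff_add[of i f "- f"] by (simp add: eq_neg_iff_add_eq_0 add.commute)

lemma pdiff_diff [simp]: "pdiff i (f - g) = pdiff i f - pdiff i g"
  using pdiff_add[of i f "- g"] by simp

lemma coeff4_eqI: "(\<And>m. coeff4 f m = coeff4 g m) \<Longrightarrow> f = g"
proof (rule fps_ext)+
  fix a b c d assume *: "\<And>m. coeff4 f m = coeff4 g m"
  show "fps_nth (fps_nth (fps_nth (fps_nth f a) b) c) d =
      fps_nth (fps_nth (fps_nth (fps_nth g a) b) c) d"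
    using *[of "\<chi> i. if i = 1 then d else if i = 2 then c else if i = 3 then b else a"]
    by (simp add: coeff4_def)
qed

lemma fps_nth_of_nat_mult: "fps_nth (of_nat k * f) n = of_nat k * fps_nth f n"
  for f :: "'a::comm_ring_1 fps"
  by (simp add: fps_of_nat[symmetric])

lemma coeff4_pdiff: "coeff4 (pdiff i f) m = of_nat (m $ i + 1) * coeff4 f (m + axis i 1)"
  using exhaust_4[of i]
  by (auto simp: coeff4_def pdiff_def axis_def fps_nth_of_nat_mult simp del: of_nat_Suc of_nat_add)

lemma pdiff_commute: "pdiff i (pdiff j f) = pdiff j (pdiff i f)"
proof (cases "i = j")
  case False
  then show ?thesis
    by (intro coeff4_eqI) (simp add: coeff4_pdiff axis_def ac_simps)
qed simp

lemma coeff4_add: "coeff4 (f + g) m = coeff4 f m + coeff4 g m"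
  and coeff4_minus: "coeff4 (- f) m = - coeff4 f m"
  and coeff4_scaleC: "coeff4 (c *\<^sub>C f) m = c * coeff4 f m"
  and coeff4_0: "coeff4 0 m = 0"
  by (simp_all add: coeff4_def scaleC_fps_def scaleC_complex_def)

lemma pdiff_scaleC: "pdiff i (c *\<^sub>C f) = c *\<^sub>C pdiff i f"
  by (intro coeff4_eqI) (simp add: coeff4_pdiff coeff4_scaleC)

text \<open>Handles one level of nesting: the hypothesis on coefficients is what the next level
  inwards supplies.\<close>

lemma scaleC_mult_fps:
  fixes f g :: "'a::{complex_vec,comm_ring_1} fps"
  assumes "\<And>x y :: 'a. c *\<^sub>C (x * y) = (c *\<^sub>C x) * y"
  shows "c *\<^sub>C (f * g) = (c *\<^sub>C f) * g"
  by (simp add: fps_eq_iff scaleC_fps_def fps_mult_nth cvec.scale_sum_right assms)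

lemma scaleC_mult_left: "c *\<^sub>C (f * g) = (c *\<^sub>C f) * (g::pseries)"
  by (intro scaleC_mult_fps) (simp add: scaleC_complex_def)

lemma scaleC_mult_right: "c *\<^sub>C (f * g) = f * (c *\<^sub>C g)" for f g :: pseries
  using scaleC_mult_left[of c g f] by (simp add: mult.commute)

lemma pdiff_of_nat [simp]: "pdiff i (of_nat n) = 0"
  by (induction n) simp_all

lemma pdiff_numeral [simp]: "pdiff i (numeral n) = 0"
  using pdiff_of_nat[of i "numeral n"] by simp

lemma coeff4_mult_2: "coeff4 (2 * f) m = 2 * coeff4 f m"
  by (simp only: mult_2 coeff4_add)

lemma half_mult_2: "(1/2) *\<^sub>C (2 * x) = (x::pseries)"
  and two_mult_half: "2 * ((1/2) *\<^sub>C x) = (x::pseries)"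
  by (intro coeff4_eqI; simp add: coeff4_scaleC coeff4_mult_2)+

lemma obtain_half:
  fixes X :: "pseries ^ 4"
  obtains Z where "X = (\<chi> i. 2 * Z i)"
  by (rule that[of "\<lambda>i. (1/2) *\<^sub>C (X $ i)"]) (simp add: two_mult_half)

subsection \<open>The Jacobi identity with one argument in \<open>L\<^sub>-\<^sub>1\<close>\<close>

text \<open>The factor \<open>1/2\<close> in the bracket of a vector field with a form stays out of the computations
  below, because one of the two arguments is always written as twice something.\<close>

lemma vf_on_form_double1:
  "vf_on_form (\<chi> i. 2 * Z i) \<omega> $ j = (\<Sum>i\<in>UNIV. 2 * (Z i * pdiff i (\<omega> $ j))
      + 2 * (\<omega> $ i * pdiff j (Z i)) - pdiff i (Z i) * \<omega> $ j)"
proof -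
  have "divergence (\<chi> i. 2 * Z i) * \<omega> $ j = 2 * (\<Sum>i\<in>UNIV. pdiff i (Z i) * \<omega> $ j)"
    by (simp add: divergence_def sum_distrib_left sum_distrib_right mult.assoc)
  then show ?thesis
    by (simp add: vf_on_form_def half_mult_2 lie_derivative_def sum.distrib sum_subtractf
        algebra_simps)
qed

lemma vf_on_form_double2:
  "vf_on_form X (\<chi> i. 2 * Z i) $ j = (\<Sum>i\<in>UNIV. 2 * (X $ i * pdiff i (Z j))
      + 2 * (Z i * pdiff j (X $ i)) - pdiff i (X $ i) * Z j)"
proof -
  have "divergence X * (2 * Z j) = 2 * (\<Sum>i\<in>UNIV. pdiff i (X $ i) * Z j)"
    by (simp add: divergence_def sum_distrib_left sum_distrib_right ac_simps)
  then have "(1/2) *\<^sub>C (divergence X * (2 * Z j)) = (\<Sum>i\<in>UNIV. pdiff i (X $ i) * Z j)"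
    by (simp only: half_mult_2)
  then show ?thesis
    by (simp add: vf_on_form_def lie_derivative_def sum.distrib sum_subtractf algebra_simps)
qed

lemma axis_nth: "axis i x $ j = (if j = i then x else 0)"
  by (simp add: axis_def)

text \<open>With the three-form expanded once and for all, the Jacobi identities below become
  identities of commutative algebra in the coefficients and their derivatives.\<close>

lemma form_bracket_nth:
  "form_bracket w t $ 1 = (pdiff 2 (w $ 3) - pdiff 3 (w $ 2)) * t $ 4 + (pdiff 3 (w $ 4)
      - pdiff 4 (w $ 3)) * t $ 2 + (pdiff 4 (w $ 2) - pdiff 2 (w $ 4)) * t $ 3
      + ((pdiff 2 (t $ 3) - pdiff 3 (t $ 2)) * w $ 4 + (pdiff 3 (t $ 4) - pdiff 4 (t $ 3)) * w $ 2
          + (pdiff 4 (t $ 2) - pdiff 2 (t $ 4)) * w $ 3)"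
  "form_bracket w t $ 2 = - ((pdiff 1 (w $ 3) - pdiff 3 (w $ 1)) * t $ 4 + (pdiff 3 (w $ 4)
      - pdiff 4 (w $ 3)) * t $ 1 + (pdiff 4 (w $ 1) - pdiff 1 (w $ 4)) * t $ 3
      + ((pdiff 1 (t $ 3) - pdiff 3 (t $ 1)) * w $ 4 + (pdiff 3 (t $ 4) - pdiff 4 (t $ 3)) * w $ 1
          + (pdiff 4 (t $ 1) - pdiff 1 (t $ 4)) * w $ 3))"
  "form_bracket w t $ 3 = (pdiff 1 (w $ 2) - pdiff 2 (w $ 1)) * t $ 4 + (pdiff 2 (w $ 4)
      - pdiff 4 (w $ 2)) * t $ 1 + (pdiff 4 (w $ 1) - pdiff 1 (w $ 4)) * t $ 2
      + ((pdiff 1 (t $ 2) - pdiff 2 (t $ 1)) * w $ 4 + (pdiff 2 (t $ 4) - pdiff 4 (t $ 2)) * w $ 1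
          + (pdiff 4 (t $ 1) - pdiff 1 (t $ 4)) * w $ 2)"
  "form_bracket w t $ 4 = - ((pdiff 1 (w $ 2) - pdiff 2 (w $ 1)) * t $ 3 + (pdiff 2 (w $ 3)
      - pdiff 3 (w $ 2)) * t $ 1 + (pdiff 3 (w $ 1) - pdiff 1 (w $ 3)) * t $ 2
      + ((pdiff 1 (t $ 2) - pdiff 2 (t $ 1)) * w $ 3 + (pdiff 2 (t $ 3) - pdiff 3 (t $ 2)) * w $ 1
          + (pdiff 3 (t $ 1) - pdiff 1 (t $ 3)) * w $ 2))"
  by (simp_all add: form_bracket_def vf_of_three_form_def wedge21_def ext_deriv_def)

lemma form_bracket_double: "form_bracket (\<chi> i. 2 * w i) t =
    (\<chi> j. 2 * form_bracket (\<chi> i. w i) t $ j)"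
  by (simp add: vec_eq_iff forall_4 form_bracket_nth algebra_simps)

lemma vf_bracket_double:
  "vf_bracket (\<chi> i. 2 * X i) Y = (\<chi> j. 2 * (\<Sum>i\<in>UNIV. X i * pdiff i (Y $ j)
      - Y $ i * pdiff i (X j)))"
  by (simp add: vf_bracket_def vec_eq_iff algebra_simps sum_distrib_left)

text \<open>The Jacobi identity for two vector fields and \<open>dx_i\<close>. The derivatives of
  the constant form drop out, which keeps the expansion small.\<close>

lemma vf_on_form_vf_bracket: "vf_on_form (vf_bracket X Y) (axis i 1) =
    vf_on_form X (vf_on_form Y (axis i 1)) -  vf_on_form Y (vf_on_form X (axis i 1))"
proof -
  obtain X' where X: "X = (\<chi> i. 2 * X' i)" by (rule obtain_half)
  obtain Y' where Y: "Y = (\<chi> i. 2 * Y' i)" by (rule obtain_half)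
  show ?thesis
    unfolding X Y vf_bracket_double vec_eq_iff vector_minus_component vf_on_form_double1 forall_4
    using exhaust_4[of i]
    by (elim disjE; simp add: sum_4 axis_nth)
      (simp_all add: pdiff_commute algebra_simps)
qed

text \<open>The Jacobi identity for a field, a form and \<open>dx_i\<close>. Under the Lie
  derivative, reading a three-form as a vector field costs one divergence term; each of the two
  forms absorbs half of it, which is the origin of the factor -1/2. The terms with the differential
  of the divergence cancel because one-forms anticommute.\<close>

lemma form_bracket_vf_on_form: "form_bracket (vf_on_form X w) (axis i 1) =
    vf_bracket X (form_bracket w (axis i 1)) - form_bracket (vf_on_form X (axis i 1)) w"
proof -
  obtain X' where X: "X = (\<chi> i. 2 * X' i)" by (rule obtain_half)
  show ?thesis
    unfolding X vf_bracket_double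
    using exhaust_4[of i]
    by (elim disjE; simp only: vec_eq_iff forall_4 vector_minus_component form_bracket_nth
        vf_on_form_double1 axis_nth sum_4; simp add: form_bracket_nth axis_nth)
      (simp_all add: pdiff_commute algebra_simps)
qed

text \<open>The Jacobi identity for three odd elements. One minus sign comes from \<open>lie\<close>
  with a form on the left of a field, the other from the sign rule.\<close>

lemma vf_on_form_form_bracket: "vf_on_form (form_bracket w t) (axis i 1) =
    - vf_on_form (form_bracket t (axis i 1)) w - vf_on_form (form_bracket w (axis i 1)) t"
proof -
  obtain w' where w: "w = (\<chi> i. 2 * w' i)" by (rule obtain_half)
  show ?thesis
    unfolding w form_bracket_double
    using exhaust_4[of i]
    by (elim disjE; simp only: vec_eq_iff forall_4 vector_minus_component  vector_uminus_component
        form_bracket_nth vf_on_form_double1  vf_on_form_double2 axis_nth sum_4 vec_lambda_beta;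
        simp add: form_bracket_nth axis_nth)
      (simp_all add: pdiff_commute algebra_simps)
qed

section \<open>Bilinearity, symmetry and signs of the bracket\<close>

lemma form_bracket_commute: "form_bracket w t = form_bracket t w"
  by (simp add: form_bracket_def add.commute)

lemma vf_bracket_antisym: "vf_bracket X Y = - vf_bracket Y X"
  by (simp add: vf_bracket_def vec_eq_iff flip: sum_negf)

lemma scaleC_vec_nth [simp]: "(c *\<^sub>C v) $ i = c *\<^sub>C v $ i"
  by (simp add: scaleC_vec_def)

lemma fst_scaleC [simp]: "fst (c *\<^sub>C v) = c *\<^sub>C fst v"
  and snd_scaleC [simp]: "snd (c *\<^sub>C v) = c *\<^sub>C snd v"
  by (simp_all add: scaleC_prod_def)

lemma lie_eq: "lie x y = (vf_bracket (fst x) (fst y) + form_bracket (snd x) (snd y),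
    vf_on_form (fst x) (snd y) - vf_on_form (fst y) (snd x))"
  by (cases x; cases y) simp

lemma additive_bilinear_lie:
  "vf_bracket (X + X') Y = vf_bracket X Y + vf_bracket X' Y"
  "form_bracket (w + w') t = form_bracket w t + form_bracket w' t"
  "vf_on_form (X + X') t = vf_on_form X t + vf_on_form X' t"
  "vf_on_form X (t + t') = vf_on_form X t + vf_on_form X t'"
  by (simp_all add: vec_eq_iff vf_bracket_def vf_on_form_def lie_derivative_def divergence_def
      form_bracket_nth forall_4 sum_4 algebra_simps scaleC_add_right)

lemma homogeneous_bilinear_lie:
  "vf_bracket (c *\<^sub>C X) Y = c *\<^sub>C vf_bracket X Y"
  "form_bracket (c *\<^sub>C w) t = c *\<^sub>C form_bracket w t"
  "vf_on_form (c *\<^sub>C X) t = c *\<^sub>C vf_on_form X t"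
  "vf_on_form X (c *\<^sub>C t) = c *\<^sub>C vf_on_form X t"
  by (simp_all add: vec_eq_iff vf_bracket_def vf_on_form_def lie_derivative_def divergence_def
      form_bracket_nth sum_4 forall_4 scaleC_add_right cvec.scale_right_diff_distrib pdiff_scaleC
      scaleC_mult_right[symmetric] scaleC_mult_left[symmetric] mult.commute
     scaleC_scaleC)
    (simp_all add: algebra_simps scaleC_add_right cvec.scale_right_diff_distrib
      scaleC_mult_right[symmetric] scaleC_mult_left[symmetric])

lemma lie_zero [simp]:
  "vf_bracket 0 Y = 0" "vf_bracket Y 0 = 0" "form_bracket 0 w = 0" "form_bracket w 0 = 0"
  "vf_on_form 0 w = 0" "vf_on_form Y 0 = 0"
  using homogeneous_bilinear_lie(1)[of 0 Y Y] homogeneous_bilinear_lie(2)[of 0 w w]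
    homogeneous_bilinear_lie(3)[of 0 Y w] homogeneous_bilinear_lie(4)[of Y 0 w]
    vf_bracket_antisym[of Y 0] form_bracket_commute[of w 0]
  by simp_all

lemma super_sign_simps [simp]: "super_sign 0 q = 1" "super_sign p 0 = 1" "super_sign 1 1 = -1"
  by (simp_all add: super_sign_def)

lemma super_sign_commute: "super_sign p q = super_sign q p"
  by (simp add: super_sign_def)

lemma parity_cases: obtains "p = 0" | "p = (1::2)"
  using exhaust_2[of p] by auto

lemma two_eq_0 [simp]: "(2::2) = 0"
  using exhaust_2[of 0] by auto

lemma super_sign_add: "super_sign p (q + r) = super_sign p q * super_sign p r"
  by (cases p rule: parity_cases; cases q rule: parity_cases; cases r rule: parity_cases) simp_all

lemma super_sign_square [simp]: "super_sign p q * super_sign p q = 1"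
  by (simp add: super_sign_def)

lemma lie_add_left: "lie (x + x') y = lie x y + lie x' y"
  by (simp add: lie_eq additive_bilinear_lie)

lemma lie_scaleC_left: "lie (c *\<^sub>C x) y = c *\<^sub>C lie x y"
  by (simp add: lie_eq homogeneous_bilinear_lie prod_eq_iff scaleC_add_right
      cvec.scale_right_diff_distrib)

lemma lie_scaleC_right: "lie x (c *\<^sub>C y) = c *\<^sub>C lie x y"
  using homogeneous_bilinear_lie(1)[of c "fst y" "fst x"] homogeneous_bilinear_lie(2)[of c "snd y"
      "snd x"]
  by (simp add: lie_eq homogeneous_bilinear_lie prod_eq_iff scaleC_add_right
      cvec.scale_right_diff_distrib
      form_bracket_commute[of "snd x"] vf_bracket_antisym[of "fst x"])

lemma lie_add_right: "lie x (y + y') = lie x y + lie x y'"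
  by (simp add: lie_eq additive_bilinear_lie form_bracket_commute[of "snd x"]
      vf_bracket_antisym[of "fst x"])

lemma lie_0_right [simp]: "lie x 0 = 0"
  by (simp add: lie_eq prod_eq_iff)

lemma lie_antisym:
  assumes "x \<in> e44_part p" "y \<in> e44_part q"
  shows "lie y x = - (super_sign p q *\<^sub>C lie x y)"
  using assms
  by (cases p rule: parity_cases; cases q rule: parity_cases)
     (auto simp: e44_part_def lie_eq vf_bracket_antisym[of "fst y"] form_bracket_commute[of
         "snd y"]
       prod_eq_iff scaleC_one)

section \<open>The basis of L_{-1}, and brackets with its elements\<close>

datatype gen = Partial 4 | Dform 4

fun gen_elt :: "gen \<Rightarrow> e44" where
  "gen_elt (Partial i) = vfield 1 i"
| "gen_elt (Dform i) = oneform 1 i"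

fun gen_parity :: "gen \<Rightarrow> 2" where
  "gen_parity (Partial i) = 0"
| "gen_parity (Dform i) = 1"

lemma gen_elt_part: "gen_elt z \<in> e44_part (gen_parity z)"
  by (cases z) (simp_all add: e44_part_def vfield_def oneform_def)

text \<open>The sign that \<open>x\<close> picks up on moving past an element of parity \<open>p\<close>.\<close>

definition twist :: "2 \<Rightarrow> e44 \<Rightarrow> e44" where
  "twist p x = (fst x, if p = 1 then - snd x else snd x)"

lemma twist_0 [simp]: "twist 0 x = x"
  by (simp add: twist_def)

lemma twist_add: "twist p (x + y) = twist p x + twist p y"
  and twist_scaleC: "twist p (c *\<^sub>C x) = c *\<^sub>C twist p x"
  by (simp_all add: twist_def prod_eq_iff)

lemma twist_homogeneous: "x \<in> e44_part q \<Longrightarrow> twist p x = super_sign p q *\<^sub>C x"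
  by (cases p rule: parity_cases; cases q rule: parity_cases)
     (auto simp: twist_def e44_part_def prod_eq_iff scaleC_one)

lemma twist_twist: "twist p (twist q x) = twist (p + q) x"
  by (cases p rule: parity_cases; cases q rule: parity_cases) (auto simp: twist_def)

lemma e44_part_lie:
  "x \<in> e44_part p \<Longrightarrow> y \<in> e44_part q \<Longrightarrow> lie x y \<in> e44_part (p + q)"
  by (cases p rule: parity_cases; cases q rule: parity_cases)
     (auto simp: e44_part_def lie_eq)

lemma e44_parts_decomp:
  obtains y z where "y \<in> e44_part 0" "z \<in> e44_part 1" "x = y + z"
  by (rule that[of "(fst x, 0)" "(0, snd x)"]) (auto simp: e44_part_def prod_eq_iff)

lemma axis_1_sum: "(\<Sum>k\<in>UNIV. axis i 1 $ k * f k) = f i" for f :: "4 \<Rightarrow> pseries"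
  by (simp add: axis_nth if_distrib[of "\<lambda>x. x * _"] cong: if_cong)

lemma pdiff_axis_1 [simp]: "pdiff k ((axis i 1 :: pseries ^ 4) $ j) = 0"
  by (simp add: axis_nth)

lemma lie_Partial:
  "lie x (gen_elt (Partial i)) = (\<chi> j. - pdiff i (fst x $ j), \<chi> j. - pdiff i (snd x $ j))"
  unfolding lie_eq gen_elt.simps vfield_def fst_conv snd_conv
  by (simp add: vf_bracket_def vf_on_form_def lie_derivative_def divergence_def
      vec_eq_iff axis_1_sum sum_negf)

lemma lie_gen_gen [simp]: "lie (gen_elt z) (gen_elt z') = 0"
  by (cases z; cases z')
    (simp_all add: lie_eq oneform_def vfield_def vf_bracket_def vf_on_form_def lie_derivative_def
      divergence_def prod_eq_iff vec_eq_iff forall_4 form_bracket_nth)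

text \<open>Each piece of the bracket is a bidifferential operator with constant coefficients, and
  partial derivatives commute, so the Leibniz rule passes to it.\<close>

lemma pdiff_bracket:
  fixes i defines "D \<equiv> (\<lambda>X. \<chi> j. pdiff i (X $ j))"
  shows "D (vf_bracket X Y) = vf_bracket (D X) Y + vf_bracket X (D Y)"
    "D (form_bracket w t) = form_bracket (D w) t + form_bracket w (D t)"
    "D (vf_on_form X t) = vf_on_form (D X) t + vf_on_form X (D t)"
  unfolding D_def
  by (simp_all add: vec_eq_iff vf_bracket_def vf_on_form_def lie_derivative_def divergence_def
      form_bracket_nth forall_4 sum_4 algebra_simps scaleC_add_right pdiff_scaleC pdiff_commute)

lemma lie_Partial_derivation:
  "lie (lie x y) (gen_elt (Partial i)) = lie x (lie y (gen_elt (Partial i)))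
      + lie (lie x (gen_elt (Partial i))) y"
proof -
  define D where "D = (\<lambda>X :: pseries ^ 4. \<chi> j. pdiff i (X $ j))"
  have lie_D: "lie x (gen_elt (Partial i)) = (- D (fst x), - D (snd x))" for x
    by (simp add: lie_Partial D_def vec_eq_iff del: gen_elt.simps)
  have D: "D (vf_bracket X Y) = vf_bracket (D X) Y + vf_bracket X (D Y)"
    "D (form_bracket w t) = form_bracket (D w) t + form_bracket w (D t)"
    "D (vf_on_form X t) = vf_on_form (D X) t + vf_on_form X (D t)"
    "D (a + b) = D a + D b" "D (a - b) = D a - D b" for X Y w t a b
    using pdiff_bracket[of i] unfolding D_def by (simp_all add: vec_eq_iff)
  have neg: "vf_bracket (- X) Y = - vf_bracket X Y" "vf_bracket Y (- X) = - vf_bracket Y X"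
     "form_bracket (- w) t = - form_bracket w t" "form_bracket t (- w) = - form_bracket t w"
     "vf_on_form (- X) t = - vf_on_form X t" "vf_on_form X (- t) = - vf_on_form X t" for X Y w t
    using homogeneous_bilinear_lie[where c = "-1"] vf_bracket_antisym[of Y]
        form_bracket_commute[of t]
    by (simp_all add: scaleC_one)
  show ?thesis
    unfolding lie_D unfolding lie_eq by (simp add: D neg)
qed

text \<open>For \<open>Partial\<close> this is the Leibniz rule; for \<open>Dform\<close> the four
  parity cases come from the three identities above, the mixed one serving twice.\<close>

lemma lie_gen_jacobi:
  assumes x: "x \<in> e44_part p" and y: "y \<in> e44_part q"
  shows "lie (lie x y) (gen_elt z) =
    lie x (lie y (gen_elt z)) + super_sign (gen_parity z) q *\<^sub>C lie (lie x (gen_elt z)) y"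
proof (cases z)
  case (Partial i)
  then show ?thesis by (simp add: lie_Partial_derivation scaleC_one del: gen_elt.simps)
next
  case (Dform i)
  note defs = lie_eq oneform_def e44_part_def Dform prod_eq_iff scaleC_one
  show ?thesis
  proof (cases p rule: parity_cases; cases q rule: parity_cases)
    assume "p = 0" "q = 0"
    with x y show ?thesis using vf_on_form_vf_bracket[of "fst x" "fst y" i]
      by (simp add: defs)
  next
    assume "p = 0" "q = 1"
    with x y show ?thesis using form_bracket_vf_on_form[of "fst x" "snd y" i]
      by (simp add: defs)
  next
    \<comment> \<open>The mixed identity again with \<open>x\<close> and \<open>y\<close> exchanged;
      antisymmetry restores the order.\<close>
    assume "p = 1" "q = 0"
    with x y show ?thesis using form_bracket_vf_on_form[of "fst y"
        "snd x" i] homogeneous_bilinear_lie(2)[of "-1"]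
      by (simp add: defs vf_bracket_antisym[of "fst y"] form_bracket_commute[of "snd x"])
  next
    assume "p = 1" "q = 1"
    with x y show ?thesis using vf_on_form_form_bracket[of "snd x" "snd y" i]
      by (simp add: defs)
  qed
qed

text \<open>The Jacobi identity with two letters, whose own bracket vanishes. It makes the action of
  \<open>x\<close> on words compatible with exchanging neighbouring letters.\<close>

lemma lie_gen_commute:
  "lie (lie x (gen_elt z)) (gen_elt z') =
    super_sign (gen_parity z) (gen_parity z') *\<^sub>C lie (lie x (gen_elt z')) (gen_elt z)"
proof -
  have hom: "lie (lie x (gen_elt z)) (gen_elt z') =
      super_sign (gen_parity z) (gen_parity z') *\<^sub>C lie (lie x (gen_elt z')) (gen_elt z)"
    if "x \<in> e44_part p" for x p
    using lie_gen_jacobi[OF that gen_elt_part, of z z']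
    by (simp add: super_sign_commute)
  show ?thesis
    using hom by (rule_tac x = x in e44_parts_decomp) (simp add: lie_add_left scaleC_add_right)
qed

subsection \<open>Splitting off the part of degree \<open>-1\<close>\<close>

fun gen_coeff :: "gen \<Rightarrow> e44 \<Rightarrow> complex" where
  "gen_coeff (Partial i) x = coeff4 (fst x $ i) 0"
| "gen_coeff (Dform i) x = coeff4 (snd x $ i) 0"

lemma UNIV_gen: "(UNIV :: gen set) = range Partial \<union> range Dform"
proof -
  have "z \<in> range Partial \<union> range Dform" for z by (cases z) auto
  then show ?thesis by blast
qed

instance gen :: finite
  by standard (simp add: UNIV_gen)

lemma sum_gen: "(\<Sum>z\<in>UNIV. h z) = (\<Sum>i\<in>UNIV. h (Partial i)) + (\<Sum>i\<in>UNIV. h (Dform i))"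
  for h :: "gen \<Rightarrow> 'a::comm_monoid_add"
  unfolding UNIV_gen by (subst sum.union_disjoint) (auto simp: sum.reindex inj_def)

lemma gen_coeff_add: "gen_coeff z (x + y) = gen_coeff z x + gen_coeff z y"
  and gen_coeff_scaleC: "gen_coeff z (c *\<^sub>C x) = c * gen_coeff z x"
  by (cases z; simp add: coeff4_add coeff4_scaleC)+

lemma coeff4_1: "coeff4 1 m = (if m = 0 then 1 else 0)"
  by (simp add: coeff4_def vec_eq_iff forall_4 fps_one_nth)

lemma gen_coeff_gen_elt: "gen_coeff z (gen_elt z') = (if z = z' then 1 else 0)"
  by (cases z; cases z') (auto simp: vfield_def oneform_def axis_nth coeff4_1 coeff4_0)

definition minus_part :: "e44 \<Rightarrow> e44" where
  "minus_part x = (\<Sum>z\<in>UNIV. gen_coeff z x *\<^sub>C gen_elt z)"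

lemma gen_coeff_sum: "gen_coeff z (sum h B) = (\<Sum>b\<in>B. gen_coeff z (h b))"
  by (induction B rule: infinite_finite_induct)
     (simp_all add: gen_coeff_add gen_coeff_scaleC[of _ 0 0, simplified])

lemma gen_coeff_minus_part: "gen_coeff z (minus_part x) = gen_coeff z x"
  by (simp add: minus_part_def gen_coeff_sum gen_coeff_scaleC gen_coeff_gen_elt
      if_distrib[of "\<lambda>a. _ * a"] cong: if_cong)

lemma twist_lie_gen:
  "twist (gen_parity z) (lie x (gen_elt z')) =
    super_sign (gen_parity z) (gen_parity z') *\<^sub>C lie (twist (gen_parity z) x) (gen_elt z')"
proof -
  have hom: "twist (gen_parity z) (lie x (gen_elt z')) =
      super_sign (gen_parity z) (gen_parity z') *\<^sub>C lie (twist (gen_parity z) x) (gen_elt z')"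
    if "x \<in> e44_part p" for x p
    by (simp add: twist_homogeneous[OF that] twist_homogeneous[OF e44_part_lie[OF that
        gen_elt_part]] lie_scaleC_left super_sign_add scaleC_scaleC mult.commute)
  show ?thesis
    by (rule e44_parts_decomp[of x]) (simp add: lie_add_left twist_add scaleC_add_right hom)
qed

lemma L_ge_0_iff: "x \<in> L_ge 0 \<longleftrightarrow> (\<forall>z. gen_coeff z x = 0)"
proof -
  have 1: "1 \<le> (\<Sum>k\<in>UNIV. int (m $ k)) \<longleftrightarrow> m \<noteq> 0" for m :: "nat ^ 4"
    by (auto simp: vec_eq_iff sum_4 forall_4)
  have 2: "(\<forall>z. gen_coeff z x = 0) \<longleftrightarrow> (\<forall>i. coeff4 (fst x $ i) 0 = 0 \<and> coeff4 (snd x $ i) 0 = 0)"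
    by (metis gen_coeff.simps gen.exhaust)
  show ?thesis
    unfolding 2 unfolding L_ge_def by (cases x) (auto simp: 1)
qed

lemma coeff4_mult_0: "coeff4 (f * g) 0 = coeff4 f 0 * coeff4 g 0"
  by (simp add: coeff4_def)

lemma coeff4_diff: "coeff4 (f - g) m = coeff4 f m - coeff4 g m"
  by (simp add: coeff4_def)

lemma coeff4_sum: "coeff4 (sum h B) m = (\<Sum>b\<in>B. coeff4 (h b) m)"
  by (induction B rule: infinite_finite_induct) (simp_all add: coeff4_0 coeff4_add)

text \<open>Every term of the bracket has an undifferentiated coefficient of one argument as a
  factor, and its constant term is zero.\<close>

lemma L_ge_0_lie:
  assumes "x \<in> L_ge 0" "y \<in> L_ge 0"
  shows "lie x y \<in> L_ge 0"
proof -
  have *: "coeff4 (fst x $ i) 0 = 0" "coeff4 (snd x $ i) 0 = 0" "coeff4 (fst y $ i) 0 = 0"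
      "coeff4 (snd y $ i) 0 = 0" for i
    using assms gen_coeff.simps unfolding L_ge_0_iff by metis+
  note simps = coeff4_sum coeff4_diff coeff4_add coeff4_scaleC coeff4_minus coeff4_mult_0 *
  have "coeff4 (form_bracket (snd x) (snd y) $ i) 0 = 0" for i
    using exhaust_4[of i] by (elim disjE) (simp_all add: form_bracket_nth simps)
  then have "gen_coeff z (lie x y) = 0" for z
    by (cases z) (simp_all add: lie_eq vf_bracket_def vf_on_form_def lie_derivative_def simps)
  then show ?thesis by (simp add: L_ge_0_iff)
qed

definition plus_part :: "e44 \<Rightarrow> e44" where
  "plus_part x = x - minus_part x"

lemma gen_coeff_diff: "gen_coeff z (x - y) = gen_coeff z x - gen_coeff z y"
  using gen_coeff_add[of z "x - y" y] by simp

lemma plus_part_in: "plus_part x \<in> L_ge 0"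
  by (simp add: L_ge_0_iff plus_part_def gen_coeff_diff gen_coeff_minus_part)

lemma minus_part_add: "minus_part (x + y) = minus_part x + minus_part y"
  and minus_part_scaleC: "minus_part (c *\<^sub>C x) = c *\<^sub>C minus_part x"
  by (simp_all add: minus_part_def gen_coeff_add gen_coeff_scaleC scaleC_add_left sum.distrib
     cvec.scale_sum_right scaleC_scaleC)

lemma plus_part_add: "plus_part (x + y) = plus_part x + plus_part y"
  and plus_part_scaleC: "plus_part (c *\<^sub>C x) = c *\<^sub>C plus_part x"
  by (simp_all add: plus_part_def minus_part_add minus_part_scaleC cvec.scale_right_diff_distrib)

lemma minus_part_of_pos: "x \<in> L_ge 0 \<Longrightarrow> minus_part x = 0"
  by (simp add: minus_part_def L_ge_0_iff)

lemma plus_part_of_pos: "x \<in> L_ge 0 \<Longrightarrow> plus_part x = x"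
  by (simp add: plus_part_def minus_part_of_pos)

lemma plus_part_gen_elt: "plus_part (gen_elt z) = 0"
  by (simp add: plus_part_def minus_part_def gen_coeff_gen_elt if_distrib[of "\<lambda>a. a *\<^sub>C _"]
      scaleC_one cong: if_cong)

lemma e44_part_add: "x \<in> e44_part p \<Longrightarrow> y \<in> e44_part p \<Longrightarrow> x + y \<in> e44_part p"
  and e44_part_scaleC: "x \<in> e44_part p \<Longrightarrow> c *\<^sub>C x \<in> e44_part p"
  and e44_part_0: "0 \<in> e44_part p"
  by (auto simp: e44_part_def split: if_splits)

lemma gen_coeff_homogeneous: "x \<in> e44_part p \<Longrightarrow> gen_parity z \<noteq> p \<Longrightarrow> gen_coeff z x = 0"
  by (cases z; cases p rule: parity_cases) (auto simp: e44_part_def coeff4_0)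

lemma e44_part_sum: "(\<And>b. b \<in> B \<Longrightarrow> h b \<in> e44_part p) \<Longrightarrow> sum h B \<in> e44_part p"
  by (induction B rule: infinite_finite_induct) (simp_all add: e44_part_0 e44_part_add)

lemma minus_part_homogeneous:
  assumes "x \<in> e44_part p"
  shows "minus_part x \<in> e44_part p"
  unfolding minus_part_def
proof (rule e44_part_sum)
  show "gen_coeff z x *\<^sub>C gen_elt z \<in> e44_part p" for z
    using gen_coeff_homogeneous[OF assms, of z] gen_elt_part[of z]
    by (cases "gen_parity z = p") (auto simp: e44_part_scaleC e44_part_0)
qed

lemma plus_part_homogeneous: "x \<in> e44_part p \<Longrightarrow> plus_part x \<in> e44_part p"
  unfolding plus_part_def using e44_part_add[OF _ e44_part_scaleC[OF minus_part_homogeneous], of x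
      p x "-1"]
  by (simp add: scaleC_one)

subsection \<open>The right action on test functions\<close>

definition additive_scaleC :: "('a::complex_vec \<Rightarrow> 'b::complex_vec) \<Rightarrow> bool" where
  "additive_scaleC f \<longleftrightarrow> (\<forall>u v. f (u + v) = f u + f v) \<and> (\<forall>c v. f (c *\<^sub>C v) = c *\<^sub>C f v)"

lemma additive_scaleCD:
  assumes "additive_scaleC f"
  shows "f (u + v) = f u + f v" "f (c *\<^sub>C v) = c *\<^sub>C f v" "f 0 = 0"
  using assms cvec.scale_zero_left[of "f 0"] unfolding additive_scaleC_def
  by (auto) (metis add_cancel_right_left add_0)

text \<open>An action of L_{>=0} on W, extended to L by zero on L_{-1}. The extension need not be a
  representation, so \<open>A_lie\<close> is confined to \<open>L_ge 0\<close>; its purpose is that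
  at the end of a word \<open>A x\<close> picks out the non-negative part of \<open>x\<close>
  without an explicit projection.\<close>

locale nonneg_rep =
  fixes A :: "e44 \<Rightarrow> 'w::complex_vec \<Rightarrow> 'w"
  assumes A_add: "A (x + y) v = A x v + A y v"
    and A_scaleC: "A (c *\<^sub>C x) v = c *\<^sub>C A x v"
    and A_lin: "additive_scaleC (A x)"
    and A_gen: "A (gen_elt z) v = 0"
    and A_lie: "\<lbrakk>x \<in> L_ge 0; x \<in> e44_part p; y \<in> L_ge 0; y \<in> e44_part q\<rbrakk> \<Longrightarrow>
      A (lie x y) v = A x (A y v) - super_sign p q *\<^sub>C A y (A x v)"
begin

text \<open>If \<open>f\<close> is read as a function on \<open>U(L\<^sub>-\<^sub>1) \<otimes> W\<close>, this is \<open>m \<mapsto> f (x m)\<close>, with \<open>x\<close>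
  moved to the right through the word by \<open>x z m = [x, z] m \<plusminus> z x m\<close>.\<close>

primrec ract :: "gen list \<Rightarrow> e44 \<Rightarrow> (gen list \<Rightarrow> 'w \<Rightarrow> 'u::complex_vec) \<Rightarrow> 'w \<Rightarrow> 'u" where
  "ract [] x f v = (\<Sum>z\<in>UNIV. gen_coeff z x *\<^sub>C f [z] v) + f [] (A x v)"
| "ract (z # zs) x f v =
    ract zs (lie x (gen_elt z)) f v + ract zs (twist (gen_parity z) x) (\<lambda>l. f (z # l)) v"

abbreviation act_fun (infixl "\<bullet>\<bullet>" 70) where "f \<bullet>\<bullet> x \<equiv> (\<lambda>zs. ract zs x f)"

text \<open>These functions of words descend to the supersymmetric algebra of L_{-1}, which is
  U(L_{-1}). Using all words instead of ordered monomials avoids straightening.\<close>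

definition supersymmetric :: "(gen list \<Rightarrow> 'w \<Rightarrow> 'u::complex_vec) \<Rightarrow> bool" where
  "supersymmetric f \<longleftrightarrow> (\<forall>as z z' bs v.
    f (as @ z # z' # bs) v = super_sign (gen_parity z) (gen_parity z') *\<^sub>C f (as @ z' # z # bs) v)"

definition test_fun :: "(gen list \<Rightarrow> 'w \<Rightarrow> 'u::complex_vec) \<Rightarrow> bool" where
  "test_fun f \<longleftrightarrow> supersymmetric f \<and> (\<forall>zs. additive_scaleC (f zs))"

lemma test_fun_lin: "test_fun f \<Longrightarrow> additive_scaleC (f zs)"
  by (simp add: test_fun_def)

lemma test_fun_Cons: "test_fun f \<Longrightarrow> test_fun (\<lambda>l. f (z # l))"
  unfolding test_fun_def supersymmetric_def by (metis append_Cons)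

lemma test_fun_swap:
  "test_fun f \<Longrightarrow> f (as @ z # z' # bs) v = super_sign (gen_parity z) (gen_parity z') *\<^sub>C f
      (as @ z' # z # bs) v"
  unfolding test_fun_def supersymmetric_def by blast

lemma ract_add: "\<forall>zs. additive_scaleC (f zs) \<Longrightarrow> ract zs (x + y) f v = ract zs x f v + ract zs y f v"
proof (induction zs arbitrary: x y f)
  case Nil
  then show ?case
    by (simp add: gen_coeff_add scaleC_add_left sum.distrib A_add additive_scaleCD)
next
  case (Cons z zs)
  then show ?case by (simp add: lie_add_left twist_add)
qed

lemma ract_scaleC: "\<forall>zs. additive_scaleC (f zs) \<Longrightarrow> ract zs (c *\<^sub>C x) f v = c *\<^sub>C ract zs x f v"
proof (induction zs arbitrary: x f)
  case Nil
  then show ?case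
    by (simp add: gen_coeff_scaleC scaleC_add_right cvec.scale_sum_right scaleC_scaleC A_scaleC
        additive_scaleCD)
next
  case (Cons z zs)
  then show ?case by (simp add: lie_scaleC_left twist_scaleC scaleC_add_right)
qed

lemma ract_fun_add: "ract zs x (\<lambda>l v. f l v + g l v) v = ract zs x f v + ract zs x g v"
  by (induction zs arbitrary: x f g) (simp_all add: scaleC_add_right sum.distrib)

lemma ract_fun_scaleC: "ract zs x (\<lambda>l v. c *\<^sub>C f l v) v = c *\<^sub>C ract zs x f v"
  by (induction zs arbitrary: x f)
     (simp_all add: scaleC_add_right cvec.scale_sum_right scaleC_scaleC mult.commute)

lemma ract_lin:
  assumes "\<forall>zs. additive_scaleC (f zs)"
  shows "additive_scaleC (ract zs x f)"
  using assms
proof (induction zs arbitrary: x f)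
  case Nil
  then show ?case
    using A_lin by (simp add: additive_scaleC_def scaleC_add_right sum.distrib
        cvec.scale_sum_right scaleC_scaleC mult.commute)
next
  case (Cons z zs)
  then show ?case by (simp add: additive_scaleC_def scaleC_add_right)
qed

text \<open>A letter has zero bracket with all others, so it travels to the end of the word at the
  cost of signs only, and supersymmetry of \<open>f\<close> brings it back to the front with the
  same signs.\<close>

lemma ract_gen:
  assumes "test_fun f"
  shows "ract zs (gen_elt y) f v = f (y # zs) v"
  using assms
proof (induction zs arbitrary: f)
  case Nil
  then show ?case
    by (simp add: gen_coeff_gen_elt if_distrib[of "\<lambda>a. a *\<^sub>C _"] scaleC_one A_gen
        additive_scaleCD(3)[OF test_fun_lin] cong: if_cong)
next
  case (Cons z zs)
  have lin: "\<forall>zs. additive_scaleC (f zs)" "\<forall>l. additive_scaleC (f (z # l))"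
    using Cons.prems by (simp_all add: test_fun_def)
  have "ract zs 0 f v = 0"
    using ract_scaleC[OF lin(1), of zs 0 0 v] by simp
  then have "ract (z # zs) (gen_elt y) f v = ract zs (twist (gen_parity z) (gen_elt y))
      (\<lambda>l. f (z # l)) v"
    by simp
  also have "\<dots> = super_sign (gen_parity z) (gen_parity y) *\<^sub>C f (z # y # zs) v"
    by (simp add: twist_homogeneous[OF gen_elt_part] ract_scaleC[OF lin(2)]
        Cons.IH[OF test_fun_Cons[OF Cons.prems]])
  also have "\<dots> = f (y # z # zs) v"
    using test_fun_swap[OF Cons.prems, of "[]" y z zs v]
    by (simp add: super_sign_commute scaleC_scaleC scaleC_one)
  finally show ?case .
qed

text \<open>For the first two letters, moving \<open>x\<close> past both gives four terms: the
  double bracket is symmetric by \<open>lie_gen_commute\<close>, the two terms with one bracket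
  change places, and the one with none is supersymmetric because \<open>f\<close> is.\<close>

lemma ract_test_fun:
  assumes "test_fun f"
  shows "test_fun (f \<bullet>\<bullet> x)"
proof -
  have "ract (as @ z # z' # bs) x f v = super_sign (gen_parity z) (gen_parity z') *\<^sub>C ract
      (as @ z' # z # bs) x f v"
    for as z z' bs v
    using assms
  proof (induction as arbitrary: x f)
    case Nil
    let ?s = "super_sign (gen_parity z) (gen_parity z')"
    have lin: "\<forall>zs. additive_scaleC (f zs)" "\<forall>l. additive_scaleC (f (z # l))"
        "\<forall>l. additive_scaleC (f (z' # l))"
      using Nil by (simp_all add: test_fun_def)
    have tw: "twist (gen_parity z) (lie x (gen_elt z')) = super_sign (gen_parity z)
        (gen_parity z') *\<^sub>C lie (twist (gen_parity z) x) (gen_elt z')" for z z' x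
      by (rule twist_lie_gen)
    have "(\<lambda>l. f (z # z' # l)) = (\<lambda>l v. ?s *\<^sub>C f (z' # z # l) v)"
      using test_fun_swap[OF Nil, of "[]" z z'] by (simp add: fun_eq_iff)
    then have ff: "ract bs y (\<lambda>l. f (z # z' # l)) v = ?s *\<^sub>C ract bs y (\<lambda>l. f (z' # z # l)) v" for y
      by (simp add: ract_fun_scaleC)
    have s: "super_sign (gen_parity z') (gen_parity z) = ?s" by (rule super_sign_commute)
    show ?case
      by (simp add: lie_gen_commute[of x z z'] ff tw ract_scaleC lin twist_twist scaleC_add_right
         scaleC_scaleC scaleC_one s ac_simps)
  next
    case (Cons a as)
    then show ?case
      using Cons.IH[OF test_fun_Cons[OF Cons.prems]] by (simp add: scaleC_add_right)
  qed
  then have "supersymmetric (f \<bullet>\<bullet> x)"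
    unfolding supersymmetric_def by blast
  moreover have "\<forall>zs. additive_scaleC ((f \<bullet>\<bullet> x) zs)"
    using assms ract_lin[of f] unfolding test_fun_def by blast
  ultimately show ?thesis
    unfolding test_fun_def by blast
qed

section \<open>The commutator law of the right action\<close>

lemma ract_commutator_gen:
  assumes f: "test_fun f" and x: "x \<in> e44_part p"
  shows "ract zs (gen_elt z) (f \<bullet>\<bullet> x) v - super_sign p (gen_parity z) *\<^sub>C ract zs x
      (f \<bullet>\<bullet> gen_elt z) v
    = ract zs (lie x (gen_elt z)) f v"
proof -
  have "f \<bullet>\<bullet> gen_elt z = (\<lambda>l. f (z # l))"
    using ract_gen[OF f] by (simp add: fun_eq_iff)
  moreover have "\<forall>l. additive_scaleC (f (z # l))"
    using f by (simp add: test_fun_def)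
  ultimately show ?thesis
    by (simp add: ract_gen[OF ract_test_fun[OF f]] twist_homogeneous[OF x] ract_scaleC
        super_sign_commute)
qed

end

lemma sign_swap:
  assumes "s = 1 \<or> s = -1" "a - s *\<^sub>C b = - (s *\<^sub>C c)"
  shows "b - s *\<^sub>C a = (c :: 'a::complex_vec)"
  using assms by (auto simp: scaleC_one algebra_simps)

lemma add_diff_cong: "a - b = c \<Longrightarrow> a' - b' = c' \<Longrightarrow> (a + a') - (b + b') = c + (c' :: 'a::ab_group_add)"
  by auto

lemma scale_diff_cong: "a - s *\<^sub>C b = c \<Longrightarrow> k *\<^sub>C a - s *\<^sub>C k *\<^sub>C b = k *\<^sub>C (c :: 'a::complex_vec)"
  by (auto simp: cvec.scale_right_diff_distrib scaleC_scaleC mult.commute)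

context nonneg_rep begin

text \<open>The claim is bilinear and super-antisymmetric in \<open>x\<close> and \<open>y\<close>,
  so both may be split along L_{-1} and L_{>=0}. If one of them is a letter,
  \<open>ract_commutator_gen\<close> applies; if both are non-negative, the claim is the module law
  \<open>A_lie\<close>.\<close>

lemma ract_commutator_Nil:
  assumes f: "test_fun f" and x: "x \<in> e44_part p" and y: "y \<in> e44_part q"
  shows "ract [] y (f \<bullet>\<bullet> x) v - super_sign p q *\<^sub>C ract [] x (f \<bullet>\<bullet> y) v = ract [] (lie x y) f v"
proof -
  define P where "P x y p q \<longleftrightarrow>
    ract [] y (f \<bullet>\<bullet> x) v - super_sign p q *\<^sub>C ract [] x (f \<bullet>\<bullet> y) v = ract [] (lie x y) f v"
    for x y p q
  note lin = f[unfolded test_fun_def, THEN conjunct2]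
  have linr: "\<forall>zs. additive_scaleC (ract zs x f)" for x
    using ract_test_fun[OF f] unfolding test_fun_def by blast
  have rneg: "ract zs (- x) f v = - ract zs x f v" for zs x
    using ract_scaleC[OF lin, of zs "-1" x v] by (simp add: scaleC_one)
  have antisym: "P x y p q" if "P y x q p" "x \<in> e44_part p" "y \<in> e44_part q" for x y p q
    using that(1) unfolding P_def lie_antisym[OF that(2,3)] rneg ract_scaleC[OF lin]
        super_sign_commute[of q p]
    by (rule sign_swap[rotated]) (simp add: super_sign_def)
  have funs: "f \<bullet>\<bullet> (x + y) = (\<lambda>l v. ract l x f v + ract l y f v)"
      "f \<bullet>\<bullet> (c *\<^sub>C x) = (\<lambda>l v. c *\<^sub>C ract l x f v)"
     for x y c
    by (simp_all add: fun_eq_iff ract_add[OF lin] ract_scaleC[OF lin])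
  have add: "P x (y + y') p q" if "P x y p q" "P x y' p q" for x y y' p q
    using that unfolding P_def funs ract_add[OF linr] ract_fun_add lie_add_right ract_add[OF lin]
        scaleC_add_right
    by (rule add_diff_cong)
  have scale: "P x (c *\<^sub>C y) p q" if "P x y p q" for x y c p q
    using that unfolding P_def funs ract_scaleC[OF linr] ract_fun_scaleC lie_scaleC_right
        ract_scaleC[OF lin]
    by (rule scale_diff_cong)
  have gen: "P x (gen_elt z) p (gen_parity z)" if "x \<in> e44_part p" for x z p
    unfolding P_def by (rule ract_commutator_gen[OF f that])
  \<comment> \<open>\<open>P\<close> carries the parities as parameters, so zero is obtained as a
    multiple of a generator of the prescribed parity \<open>q\<close>.\<close>
  have zero: "P x 0 p q" if "x \<in> e44_part p" for x p q
    using scale[of x "gen_elt (if q = 0 then Partial 1 else Dform 1)" p q 0] gen[OF that, of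
        "if q = 0 then Partial 1 else Dform 1"]
    by (cases q rule: parity_cases) simp_all
  have minus: "P x (minus_part y) p q" if "x \<in> e44_part p" "y \<in> e44_part q" for x y p q
  proof -
    have "P x (\<Sum>z\<in>Z. gen_coeff z y *\<^sub>C gen_elt z) p q" if "finite Z" for Z
      using that
    proof induction
      case empty
      show ?case using zero[OF \<open>x \<in> e44_part p\<close>] by simp
    next
      case (insert z Z)
      have "P x (gen_coeff z y *\<^sub>C gen_elt z) p q"
      proof (cases "gen_parity z = q")
        case True
        then show ?thesis using gen[OF \<open>x \<in> e44_part p\<close>, of z] scale by blast
      next
        case False
        then show ?thesis using zero[OF \<open>x \<in> e44_part p\<close>] gen_coeff_homogeneous[OF
            \<open>y \<in> e44_part q\<close>] by simp
      qed
      with insert add show ?case by simp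
    qed
    then show ?thesis by (simp add: minus_part_def)
  qed
  have plus: "P x y p q" if "x \<in> L_ge 0" "x \<in> e44_part p" "y \<in> L_ge 0" "y \<in> e44_part q" for x y p q
  proof -
    have "gen_coeff z x = 0" "gen_coeff z y = 0" "gen_coeff z (lie x y) = 0" for z
      using that L_ge_0_lie by (auto simp: L_ge_0_iff)
    then show ?thesis
      unfolding P_def using A_lie[OF that]
      by (simp add: additive_scaleCD[OF lin[rule_format]])
        (metis additive_scaleCD(1,2)[OF lin[rule_format]] diff_add_cancel eq_diff_eq)
  qed
  have "P x y p q"
  proof -
    have 1: "P x' (minus_part y + plus_part y) p q" if "P x' (plus_part y) p q" "x' \<in> e44_part p"
        for x'
      using add[OF minus[OF that(2) y] that(1)] .
    \<comment> \<open>\<open>add\<close> and \<open>minus\<close> concern the right argument only,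
      so \<open>x\<close> is split with the roles exchanged and \<open>antisym\<close> turns the
      result round.\<close>
    have "P (plus_part y) (minus_part x + plus_part x) q p"
      by (intro add minus plus plus_part_in plus_part_homogeneous x y)
    then have "P x (plus_part y) p q"
      using antisym plus_part_homogeneous[OF y] x by (simp add: plus_part_def)
    then show ?thesis
      using 1[OF _ x] by (simp add: plus_part_def)
  qed
  then show ?thesis by (simp only: P_def)
qed

text \<open>Moving \<open>x\<close> and \<open>y\<close> past the first letter z reduces the claim
  to the pairs (x, [y,z]), ([x,z], y) and (x, y) on the shorter word. The brackets of the first two
  pairs add up to [[x,y],z] by \<open>lie_gen_jacobi\<close>.\<close>

lemma ract_commutator:
  assumes "test_fun f" "x \<in> e44_part p" "y \<in> e44_part q"
  shows "ract zs y (f \<bullet>\<bullet> x) v - super_sign p q *\<^sub>C ract zs x (f \<bullet>\<bullet> y) v = ract zs (lie x y) f v"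
  using assms
proof (induction zs arbitrary: f x y p q)
  case Nil
  then show ?case by (rule ract_commutator_Nil)
next
  case (Cons z zs)
  let ?r = "gen_parity z"
  note f = Cons.prems(1) and x = Cons.prems(2) and y = Cons.prems(3)
  note part = gen_elt_part[of z]
  have lin: "\<forall>zs. additive_scaleC (f zs)" "\<forall>l. additive_scaleC (f (z # l))"
      "\<forall>l. additive_scaleC (ract l x (\<lambda>l. f (z # l)))" for x
    using f ract_lin[of "\<lambda>l. f (z # l)"] by (simp_all add: test_fun_def)
  have tail: "(\<lambda>l. ract (z # l) x f) = (\<lambda>l v. ract l (lie x (gen_elt z)) f v + super_sign ?r p *\<^sub>C
      ract l x (\<lambda>l. f (z # l)) v)"
    if "x \<in> e44_part p" for x p
    by (simp add: fun_eq_iff twist_homogeneous[OF that] ract_scaleC lin)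
  have step: "ract (z # zs) y (f \<bullet>\<bullet> x) v = ract zs (lie y (gen_elt z)) (f \<bullet>\<bullet> x) v
      + super_sign ?r q *\<^sub>C ract zs y (f \<bullet>\<bullet> lie x (gen_elt z)) v
      + (super_sign ?r p * super_sign ?r q) *\<^sub>C ract zs y ((\<lambda>l. f (z # l)) \<bullet>\<bullet> x) v"
    if "x \<in> e44_part p" "y \<in> e44_part q" for x y p q
  proof -
    have linr: "\<forall>l. additive_scaleC (ract l x f)" for x
      using ract_lin[OF lin(1)] by blast
    show ?thesis
      by (simp only: ract.simps(2)[of z zs y] tail[OF that(1)] twist_homogeneous[OF that(2)]
          ract_scaleC[OF linr] ract_scaleC[OF lin(3)] ract_fun_add
        ract_fun_scaleC scaleC_add_right scaleC_scaleC mult.commute add.assoc)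
  qed
  have xz: "lie x (gen_elt z) \<in> e44_part (p + ?r)" and yz: "lie y (gen_elt z) \<in> e44_part (q + ?r)"
    using x y part by (simp_all add: e44_part_lie)
  have IH1: "ract zs (lie y (gen_elt z)) (f \<bullet>\<bullet> x) v =
     super_sign p (q + ?r) *\<^sub>C ract zs x (f \<bullet>\<bullet> lie y (gen_elt z)) v
         + ract zs (lie x (lie y (gen_elt z))) f v"
    using Cons.IH[OF f x yz] by (simp add: algebra_simps)
  have IH2: "ract zs y (f \<bullet>\<bullet> lie x (gen_elt z)) v =
     super_sign (p + ?r) q *\<^sub>C ract zs (lie x (gen_elt z)) (f \<bullet>\<bullet> y) v
         + ract zs (lie (lie x (gen_elt z)) y) f v"
    using Cons.IH[OF f xz y] by (simp add: algebra_simps)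
  have IH3: "ract zs y ((\<lambda>l. f (z # l)) \<bullet>\<bullet> x) v =
     super_sign p q *\<^sub>C ract zs x ((\<lambda>l. f (z # l)) \<bullet>\<bullet> y) v + ract zs (lie x y) (\<lambda>l. f (z # l)) v"
    using Cons.IH[OF test_fun_Cons[OF f] x y] by (simp add: algebra_simps)
  have rhs: "ract (z # zs) (lie x y) f v = ract zs (lie x (lie y (gen_elt z))) f v
      + super_sign ?r q *\<^sub>C ract zs (lie (lie x (gen_elt z)) y) f v
      + (super_sign ?r p * super_sign ?r q) *\<^sub>C ract zs (lie x y) (\<lambda>l. f (z # l)) v"
    by (simp add: lie_gen_jacobi[OF x y] twist_homogeneous[OF e44_part_lie[OF x y]]
        ract_add[OF lin(1)] ract_scaleC[OF lin(1)] ract_scaleC[OF lin(2)] super_sign_add)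
  have s: "super_sign (p + ?r) q = super_sign p q * super_sign ?r q"
    "super_sign p (q + ?r) = super_sign p q * super_sign ?r p"
    using super_sign_add[of q p ?r] super_sign_add[of p q ?r] by (simp_all add: super_sign_commute)
  have sq: "super_sign ?r q * (super_sign p q * super_sign ?r q) = super_sign p q"
    by (simp add: super_sign_def)
  show ?case
    unfolding step[OF x y] step[OF y x] IH1 IH2 IH3 rhs s
    by (simp add: scaleC_add_right scaleC_scaleC sq ac_simps)
qed

end

lemma additive_scaleC_sum: "additive_scaleC f \<Longrightarrow> f (sum h B) = (\<Sum>b\<in>B. f (h b))"
  by (induction B rule: infinite_finite_induct) (simp_all add: additive_scaleCD)

lemma additive_scaleC_minus: "additive_scaleC f \<Longrightarrow> f (- v) = - f v"
  using additive_scaleCD(2)[of f "-1" v] by (simp add: scaleC_one)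

lemma additive_scaleC_diff: "additive_scaleC f \<Longrightarrow> f (u - v) = f u - f v"
  using additive_scaleCD(1)[of f u "- v"] by (simp add: additive_scaleC_minus)

lemma additive_scaleC_span:
  assumes "additive_scaleC f" "\<And>u. u \<in> S \<Longrightarrow> f u = 0" "u \<in> cvec.span S"
  shows "f u = 0"
proof -
  have "cvec.subspace {u. f u = 0}"
    using assms(1) by (simp add: cvec.subspace_def additive_scaleCD)
  then show ?thesis
    using assms(2,3) cvec.span_minimal[of S "{u. f u = 0}"] by blast
qed

lemma lookup_scaleC: "Poly_Mapping.lookup (c *\<^sub>C u) k = c *\<^sub>C Poly_Mapping.lookup u k"
  by transfer simp

subsection \<open>Pairing with the induced module\<close>

definition lin_ext :: "('k \<Rightarrow> 'u::complex_vec) \<Rightarrow> ('k \<Rightarrow>\<^sub>0 complex) \<Rightarrow> 'u" where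
  "lin_ext h u = (\<Sum>k\<in>Poly_Mapping.keys u. Poly_Mapping.lookup u k *\<^sub>C h k)"

lemma lin_ext_superset:
  "finite K \<Longrightarrow> Poly_Mapping.keys u \<subseteq> K \<Longrightarrow> lin_ext h u = (\<Sum>k\<in>K. Poly_Mapping.lookup u k *\<^sub>C h k)"
  unfolding lin_ext_def by (rule sum.mono_neutral_left) (auto simp: in_keys_iff)

lemma additive_scaleC_lin_ext: "additive_scaleC (lin_ext h)"
  unfolding additive_scaleC_def
proof (intro conjI allI)
  fix u v :: "'a \<Rightarrow>\<^sub>0 complex" and c
  let ?K = "Poly_Mapping.keys u \<union> Poly_Mapping.keys v"
  show "lin_ext h (u + v) = lin_ext h u + lin_ext h v"
    using Poly_Mapping.keys_add[of u v]
    by (simp add: lin_ext_superset[of ?K] lookup_add scaleC_add_left sum.distrib)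
  show "lin_ext h (c *\<^sub>C u) = c *\<^sub>C lin_ext h u"
  proof -
    have "lin_ext h (c *\<^sub>C u) = (\<Sum>k\<in>Poly_Mapping.keys u. (c * Poly_Mapping.lookup u k) *\<^sub>C h k)"
      by (subst lin_ext_superset[of "Poly_Mapping.keys u"])
         (auto simp: in_keys_iff lookup_scaleC scaleC_complex_def)
    then show ?thesis
      by (simp only: lin_ext_def cvec.scale_sum_right scaleC_scaleC)
  qed
qed

lemma lin_ext_single: "lin_ext h (Poly_Mapping.single k 1) = h k"
  by (simp add: lin_ext_def scaleC_one)

lemma lin_ext_tens: "lin_ext h (tens xs v) = h (xs, v)"
  by (simp add: tens_def lin_ext_single)

lemma lin_ext_add: "lin_ext (\<lambda>k. h k + h' k) u = lin_ext h u + lin_ext h' u"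
  and lin_ext_scaleC: "lin_ext (\<lambda>k. c *\<^sub>C h k) u = c *\<^sub>C lin_ext h u"
  by (simp_all add: lin_ext_def scaleC_add_right sum.distrib cvec.scale_sum_right scaleC_scaleC
      mult.commute)

context nonneg_rep begin

text \<open>The value of \<open>f\<close> at x_1 ... x_n v for arbitrary x_i in L: the factors act
  on \<open>f\<close> from the left end, and what remains is evaluated at the empty word.\<close>

primrec pairing :: "e44 list \<Rightarrow> (gen list \<Rightarrow> 'w \<Rightarrow> 'u::complex_vec) \<Rightarrow> 'w \<Rightarrow> 'u" where
  "pairing [] f v = f [] v"
| "pairing (x # xs) f v = pairing xs (f \<bullet>\<bullet> x) v"

lemma pairing_lin: "test_fun f \<Longrightarrow> additive_scaleC (pairing xs f)"
proof (induction xs arbitrary: f)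
  case Nil
  then show ?case using test_fun_lin[OF Nil, of "[]"] by (simp add: additive_scaleC_def)
next
  case (Cons x xs)
  show ?case using Cons.IH[OF ract_test_fun[OF Cons.prems]] by (simp add: additive_scaleC_def)
qed

lemma act_fun_add: "(\<lambda>l v. f l v + h l v) \<bullet>\<bullet> x = (\<lambda>l v. (f \<bullet>\<bullet> x) l v + (h \<bullet>\<bullet> x) l v)"
  and act_fun_scaleC: "(\<lambda>l v. c *\<^sub>C f l v) \<bullet>\<bullet> x = (\<lambda>l v. c *\<^sub>C (f \<bullet>\<bullet> x) l v)"
  by (simp_all add: fun_eq_iff ract_fun_add ract_fun_scaleC)

lemma pairing_fun_add: "pairing xs (\<lambda>l v. f l v + h l v) v = pairing xs f v + pairing xs h v"
  by (induction xs arbitrary: f h) (simp_all add: act_fun_add)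

lemma pairing_fun_scaleC: "pairing xs (\<lambda>l v. c *\<^sub>C f l v) v = c *\<^sub>C pairing xs f v"
  by (induction xs arbitrary: f) (simp_all add: act_fun_scaleC)

lemma pairing_lin_alg:
  assumes "test_fun f"
  shows "pairing (xs @ (c *\<^sub>C x + y) # ys) f v = c *\<^sub>C pairing (xs @ x # ys) f v
      + pairing (xs @ y # ys) f v"
  using assms
proof (induction xs arbitrary: f)
  case Nil
  then have "\<forall>zs. additive_scaleC (f zs)"
    by (simp add: test_fun_def)
  then have "f \<bullet>\<bullet> (c *\<^sub>C x + y) = (\<lambda>l v. c *\<^sub>C (f \<bullet>\<bullet> x) l v + (f \<bullet>\<bullet> y) l v)"
    by (simp add: fun_eq_iff ract_add ract_scaleC)
  then show ?case
    by (simp add: pairing_fun_add pairing_fun_scaleC)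
next
  case (Cons a xs)
  then show ?case by (simp add: ract_test_fun)
qed

lemma pairing_envelop:
  assumes "test_fun f" "x \<in> e44_part p" "y \<in> e44_part q"
  shows "pairing (xs @ x # y # ys) f v =
    super_sign p q *\<^sub>C pairing (xs @ y # x # ys) f v + pairing (xs @ lie x y # ys) f v"
  using assms(1)
proof (induction xs arbitrary: f)
  case Nil
  have "ract l y (f \<bullet>\<bullet> x) v = super_sign p q *\<^sub>C ract l x (f \<bullet>\<bullet> y) v + ract l (lie x y) f v" for l v
    using ract_commutator[OF Nil assms(2,3), of l v] by (simp add: algebra_simps)
  then have "f \<bullet>\<bullet> x \<bullet>\<bullet> y = (\<lambda>l v. super_sign p q *\<^sub>C (f \<bullet>\<bullet> y \<bullet>\<bullet> x) l v + (f \<bullet>\<bullet> lie x y) l v)"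
    by (simp add: fun_eq_iff)
  then show ?case
    by (simp add: pairing_fun_add pairing_fun_scaleC)
next
  case (Cons a xs)
  then show ?case by (simp add: ract_test_fun)
qed

text \<open>At the empty word an element of L_{>=0} has no letters to contribute, so only its action
  on W is left.\<close>

lemma pairing_balanced:
  assumes "test_fun f" "x \<in> L_ge 0"
  shows "pairing (xs @ [x]) f v = pairing xs f (A x v)"
  using assms(1)
proof (induction xs arbitrary: f)
  case Nil
  then show ?case
    using assms(2) by (simp add: L_ge_0_iff)
next
  case (Cons a xs)
  then show ?case by (simp add: ract_test_fun)
qed

end

section \<open>Linear sections of quotients, and the pairing for a subquotient W\<close>

lemma linear_additive_scaleC: "Vector_Spaces.linear scaleC scaleC f \<Longrightarrow> additive_scaleC f"
  by (simp add: additive_scaleC_def Vector_Spaces.linear_iff)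

text \<open>Take a basis of \<open>N\<close>, extend it to one of \<open>U\<close> and then to one
  of the whole space; \<open>g\<close> keeps the vectors added in the second stage and kills all
  others. It is applied to W inside its type, and to the Verma module with \<open>U\<close> the
  whole type.\<close>

lemma quotient_projection:
  fixes N U :: "'a::complex_vec set"
  assumes N: "cvec.subspace N" and U: "cvec.subspace U" and "N \<subseteq> U"
  shows "\<exists>g. additive_scaleC g \<and> (\<forall>v. g v \<in> U) \<and> (\<forall>v\<in>U. g v - v \<in> N) \<and> (\<forall>v\<in>N. g v = 0)"
proof -
  interpret vector_space_pair "scaleC :: complex \<Rightarrow> 'a \<Rightarrow> 'a" "scaleC :: complex \<Rightarrow> 'a \<Rightarrow> 'a"
    by unfold_locales
  obtain B0 where B0: "B0 \<subseteq> N" "cvec.independent B0" "N \<subseteq> cvec.span B0"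
    by (rule cvec.maximal_independent_subset[of N])
  obtain B1 where B1: "B0 \<subseteq> B1" "B1 \<subseteq> U" "cvec.independent B1" "U \<subseteq> cvec.span B1"
    by (rule cvec.maximal_independent_subset_extend[OF order_trans[OF B0(1) \<open>N \<subseteq> U\<close>] B0(2)])
  obtain B where B: "B1 \<subseteq> B" "cvec.independent B" "UNIV \<subseteq> cvec.span B"
    by (rule cvec.maximal_independent_subset_extend[OF subset_UNIV B1(3)])
  obtain g where g: "Vector_Spaces.linear scaleC scaleC g"
    "\<forall>x\<in>B. g x = (if x \<in> B1 - B0 then x else 0)"
    using linear_independent_extend[OF B(2), of "\<lambda>x. if x \<in> B1 - B0 then x else 0"] by blast
  have lin: "additive_scaleC g" by (rule linear_additive_scaleC[OF g(1)])
  have inU: "g v \<in> U" for v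
  proof -
    have "cvec.subspace {v. g v \<in> U}"
      using U lin by (auto simp: cvec.subspace_def additive_scaleCD)
    moreover have "B \<subseteq> {v. g v \<in> U}"
      using g(2) B1(2) cvec.subspace_0[OF U] by auto
    ultimately show ?thesis
      using cvec.span_minimal[of B "{v. g v \<in> U}"] B(3) by blast
  qed
  have N_eq: "g v - v \<in> N" if "v \<in> U" for v
  proof -
    have "cvec.subspace {v. g v - v \<in> N}"
      using cvec.subspace_add[OF N] cvec.subspace_scale[OF N] cvec.subspace_0[OF N]
      by (auto simp: cvec.subspace_def additive_scaleCD[OF lin] add_diff_add
          cvec.scale_right_diff_distrib[symmetric])
    moreover have "B1 \<subseteq> {v. g v - v \<in> N}"
    proof
      fix x assume "x \<in> B1"
      then have "g x = (if x \<in> B0 then 0 else x)"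
        using g(2) B(1) by auto
      then show "x \<in> {v. g v - v \<in> N}"
        using B0(1) cvec.subspace_0[OF N] cvec.subspace_neg[OF N] by auto
    qed
    ultimately show ?thesis
      using cvec.span_minimal[of B1 "{v. g v - v \<in> N}"] B1(4) that by blast
  qed
  have "g v = 0" if "v \<in> N" for v
    by (rule additive_scaleC_span[OF lin, of B0]) (use g(2) B(1) B1(1) B0(3) that in auto)
  with lin inU N_eq show ?thesis by blast
qed

text \<open>The action on a module is linear only on the carrier, and only modulo the null space.
  Composed with a projection \<open>g\<close> onto a complement of the null space it becomes linear on the
  whole type.\<close>

locale module_projection =
  fixes W :: "'w::complex_vec supermod" and g :: "'w \<Rightarrow> 'w"
  assumes W: "supermodule (L_ge 0) W"
    and g_lin: "additive_scaleC g"
    and g_carrier: "g v \<in> carrier_sp W"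
    and g_cong: "v \<in> carrier_sp W \<Longrightarrow> g v - v \<in> null_sp W"
    and g_null: "v \<in> null_sp W \<Longrightarrow> g v = 0"
begin

lemma g_eq_in: "eq_in W u v \<Longrightarrow> g u = g v"
  using g_null[of "u - v"] by (simp add: eq_in_def additive_scaleC_diff[OF g_lin])

lemma g_idem: "v \<in> carrier_sp W \<Longrightarrow> g (g v) = g v"
  using g_eq_in[of "g v" v] g_cong by (simp add: eq_in_def)

lemmas W_axioms = W[unfolded supermodule_def]
lemmas null_carrier = W_axioms[THEN conjunct2, THEN conjunct2, THEN conjunct1]
lemmas act_null_all = W_axioms[THEN conjunct2, THEN conjunct2, THEN conjunct2, THEN conjunct2,
    THEN conjunct1]
lemmas act_carrier_all = W_axioms[THEN conjunct2, THEN conjunct2, THEN conjunct2, THEN conjunct2,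
    THEN conjunct2, THEN conjunct1]
lemmas act_lin_mod_all = W_axioms[THEN conjunct2, THEN conjunct2, THEN conjunct2, THEN conjunct2,
    THEN conjunct2, THEN conjunct2, THEN conjunct2, THEN conjunct1]
lemmas act_lin_alg_all = W_axioms[THEN conjunct2, THEN conjunct2, THEN conjunct2, THEN conjunct2,
    THEN conjunct2, THEN conjunct2, THEN conjunct2, THEN conjunct2, THEN conjunct1]
lemmas act_lie_all = W_axioms[THEN conjunct2, THEN conjunct2, THEN conjunct2, THEN conjunct2, THEN
    conjunct2, THEN conjunct2, THEN conjunct2, THEN conjunct2, THEN conjunct2]

lemma act_carrier: "x \<in> L_ge 0 \<Longrightarrow> v \<in> carrier_sp W \<Longrightarrow> act W x v \<in> carrier_sp W"
  using act_carrier_all by (elim ballE) auto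

lemma act_null: "x \<in> L_ge 0 \<Longrightarrow> v \<in> null_sp W \<Longrightarrow> act W x v \<in> null_sp W"
  using act_null_all by (elim ballE) auto

lemma act_lin_mod:
  assumes "x \<in> L_ge 0" "u \<in> carrier_sp W" "v \<in> carrier_sp W"
  shows "g (act W x (c *\<^sub>C u + v)) = c *\<^sub>C g (act W x u) + g (act W x v)"
  using g_eq_in[OF act_lin_mod_all[rule_format, OF assms]]
  by (simp add: additive_scaleCD[OF g_lin])

lemma act_lin_alg:
  assumes "x \<in> L_ge 0" "y \<in> L_ge 0" "v \<in> carrier_sp W"
  shows "g (act W (c *\<^sub>C x + y) v) = c *\<^sub>C g (act W x v) + g (act W y v)"
  using g_eq_in[OF act_lin_alg_all[rule_format, OF assms]]
  by (simp add: additive_scaleCD[OF g_lin])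

lemma act_lie:
  assumes "x \<in> L_ge 0" "x \<in> e44_part p" "y \<in> L_ge 0" "y \<in> e44_part q" "v \<in> carrier_sp W"
  shows "g (act W (lie x y) v) = g (act W x (act W y v)) - super_sign p q *\<^sub>C g
      (act W y (act W x v))"
  using g_eq_in[OF act_lie_all[rule_format, OF IntI IntI, OF assms]]
  by (simp add: additive_scaleC_diff[OF g_lin] additive_scaleCD[OF g_lin])

lemma zero_L_ge_0: "0 \<in> L_ge 0"
  using plus_part_in[of 0] plus_part_scaleC[of 0 0] by simp

lemma act_g: "x \<in> L_ge 0 \<Longrightarrow> v \<in> carrier_sp W \<Longrightarrow> g (act W x (g v)) = g (act W x v)"
  using act_lin_mod[of x v "g v - v" 1] act_null[of x "g v - v"] g_cong[of v] null_carrier g_null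
  by (auto simp: scaleC_one)

text \<open>The inner \<open>g\<close> moves the argument into the carrier, where the module axioms
  hold; the outer \<open>g\<close> turns their congruences into equations; \<open>plus_part\<close>
  kills the letters.\<close>

definition A :: "e44 \<Rightarrow> 'w \<Rightarrow> 'w" where
  "A x v = g (act W (plus_part x) (g v))"

sublocale nonneg_rep A
proof
  have zero: "g (act W 0 (g v)) = 0" for v
    using act_lin_alg[OF zero_L_ge_0 zero_L_ge_0 g_carrier, of 1 v] by (simp add: scaleC_one)
  show scale: "A (c *\<^sub>C x) v = c *\<^sub>C A x v" for c x v
    using act_lin_alg[OF plus_part_in[of x] zero_L_ge_0 g_carrier, of c v] zero[of v]
    by (simp add: A_def plus_part_scaleC)
  show "A (x + y) v = A x v + A y v" for x y v
    using act_lin_alg[OF plus_part_in[of x] plus_part_in[of y] g_carrier, of 1 v]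
    by (simp add: A_def plus_part_add scaleC_one)
  have "0 \<in> carrier_sp W"
    using g_carrier[of 0] additive_scaleCD(3)[OF g_lin] by simp
  then have zero': "g (act W x 0) = 0" if "x \<in> L_ge 0" for x
    using act_lin_mod[OF that, of 0 0 1] by (simp add: scaleC_one)
  show "additive_scaleC (A x)" for x
    unfolding additive_scaleC_def A_def additive_scaleCD[OF g_lin]
  proof (intro conjI allI)
    fix u v c
    show "g (act W (plus_part x) (g u + g v)) = g (act W (plus_part x) (g u))
        + g (act W (plus_part x) (g v))"
      using act_lin_mod[OF plus_part_in[of x] g_carrier g_carrier, of 1 u v] by (simp add:
          scaleC_one)
    show "g (act W (plus_part x) (c *\<^sub>C g v)) = c *\<^sub>C g (act W (plus_part x) (g v))"
      using act_lin_mod[OF plus_part_in[of x] g_carrier \<open>0 \<in> carrier_sp W\<close>, of c v]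
      by (simp add: zero'[OF plus_part_in])
  qed
  show "A (gen_elt z) v = 0" for z v
    by (simp add: A_def plus_part_gen_elt zero)
  show "A (lie x y) v = A x (A y v) - super_sign p q *\<^sub>C A y (A x v)"
    if "x \<in> L_ge 0" "x \<in> e44_part p" "y \<in> L_ge 0" "y \<in> e44_part q" for x p y q v
    using act_lie[OF that g_carrier, of v] that L_ge_0_lie[OF that(1,3)]
    by (simp add: A_def plus_part_of_pos act_g act_carrier g_carrier g_idem)
qed

lemma A_eq: "x \<in> L_ge 0 \<Longrightarrow> v \<in> carrier_sp W \<Longrightarrow> A x (g v) = g (act W x v)"
  by (simp add: A_def plus_part_of_pos act_g g_carrier g_idem)

definition Psi :: "(gen list \<Rightarrow> 'w \<Rightarrow> 'u::complex_vec) \<Rightarrow> ((e44 list \<times> 'w) \<Rightarrow>\<^sub>0 complex) \<Rightarrow> 'u" where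
  "Psi f = lin_ext (\<lambda>(xs, v). pairing xs f (g v))"

lemma Psi_lin: "additive_scaleC (Psi f)"
  by (simp add: Psi_def additive_scaleC_lin_ext)

lemma Psi_tens: "Psi f (tens xs v) = pairing xs f (g v)"
  by (simp add: Psi_def lin_ext_tens)

lemmas Psi_simps = additive_scaleCD[OF Psi_lin] additive_scaleC_diff[OF Psi_lin] Psi_tens

lemma Psi_ind_rel:
  assumes f: "test_fun f" and "u \<in> ind_rel UNIV (L_ge 0) W"
  shows "Psi f u = 0"
  using assms(2)
proof cases
  case (lin_alg xs ys x y v c)
  then show ?thesis by (simp add: Psi_simps pairing_lin_alg[OF f])
next
  case (lin_mod xs u v c)
  then show ?thesis
    by (simp add: Psi_simps additive_scaleCD[OF g_lin] additive_scaleCD[OF pairing_lin[OF f]])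
next
  case (null_mod xs v)
  then show ?thesis by (simp add: Psi_simps g_null additive_scaleCD[OF pairing_lin[OF f]])
next
  case (envelop xs ys x p y q v)
  then show ?thesis
    using pairing_envelop[OF f, of x p y q] by (simp add: Psi_simps)
next
  case (balanced xs x v)
  then show ?thesis by (simp add: Psi_simps pairing_balanced[OF f] A_eq)
qed

lemma Psi_null: "test_fun f \<Longrightarrow> u \<in> null_sp (Verma W) \<Longrightarrow> Psi f u = 0"
  using additive_scaleC_span[OF Psi_lin Psi_ind_rel] by (simp add: Verma_def Ind_def)

text \<open>The action prepends \<open>x\<close> to each word, and \<open>pairing\<close> lets the
  first factor act on \<open>f\<close>. This turns the annihilation of a vector into conditions on
  test functions.\<close>

lemma Psi_act: "Psi f (act (Verma W) x u) = Psi (\<lambda>zs. ract zs x f) u"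
proof -
  have "act (Verma W) x u = lin_ext (\<lambda>(xs, v). tens (x # xs) v) u"
    by (simp add: Verma_def Ind_def lin_ext_def case_prod_beta)
  then have "Psi f (act (Verma W) x u) =
      (\<Sum>k\<in>Poly_Mapping.keys u. Poly_Mapping.lookup u k *\<^sub>C Psi f (case k of (xs, v) \<Rightarrow>
          tens (x # xs) v))"
    by (simp only: lin_ext_def additive_scaleC_sum[OF Psi_lin] additive_scaleCD[OF Psi_lin])
  also have "\<dots> = Psi (\<lambda>zs. ract zs x f) u"
    by (simp add: Psi_tens case_prod_beta) (simp add: Psi_def lin_ext_def case_prod_beta)
  finally show ?thesis .
qed

end

section \<open>Vectors of fixed degree, and separation of points by test functions\<close>

lemma fst_sum: "fst (sum h B) = (\<Sum>b\<in>B. fst (h b))"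
  and snd_sum: "snd (sum h B) = (\<Sum>b\<in>B. snd (h b))"
  by (induction B rule: infinite_finite_induct) simp_all

lemma minus_part_L_deg:
  assumes "x \<in> L_deg (-1)"
  shows "minus_part x = x"
proof -
  have "m = 0" if "coeff4 (fst x $ j) m \<noteq> 0 \<or> coeff4 (snd x $ j) m \<noteq> 0" for j m
  proof -
    have "int (\<Sum>k\<in>UNIV. m $ k) = 0"
      using assms that unfolding L_deg_def by (cases x) auto
    then show ?thesis
      by (auto simp: vec_eq_iff sum_4 forall_4)
  qed
  then have x: "coeff4 (fst x $ j) m = 0" "coeff4 (snd x $ j) m = 0" if "m \<noteq> 0" for j m
    using that by blast+
  have pick: "(\<Sum>i\<in>UNIV. c i *\<^sub>C axis i (1::pseries) $ j) = c j *\<^sub>C 1" for c j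
    by (simp add: axis_nth if_distrib[of "\<lambda>a. _ *\<^sub>C a"] cong: if_cong)
  show ?thesis
    by (rule prod_eqI; rule vec_eq_iff[THEN iffD2, rule_format]; rule coeff4_eqI)
       (use x in \<open>simp_all add: minus_part_def sum_gen vfield_def oneform_def fst_sum snd_sum pick
          coeff4_scaleC coeff4_1\<close>)
qed

context nonneg_rep begin

lemma ract_minus_part:
  assumes "test_fun f"
  shows "ract zs (minus_part x) f v = (\<Sum>z\<in>UNIV. gen_coeff z x *\<^sub>C f (z # zs) v)"
proof -
  have "\<forall>zs. additive_scaleC (f zs)"
    using assms by (simp add: test_fun_def)
  then have lin: "additive_scaleC (\<lambda>x. ract zs x f v)"
    by (simp add: additive_scaleC_def ract_add ract_scaleC)
  show ?thesis
    unfolding minus_part_def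
    by (simp add: additive_scaleC_sum[OF lin] additive_scaleCD(2)[OF lin] ract_gen[OF assms])
qed

text \<open>Each factor from L_{-1} acts by prepending one letter, so only the values of
  \<open>f\<close> on words as long as \<open>xs\<close> enter.\<close>

lemma pairing_vanish:
  assumes "test_fun f" "xs \<in> lists (L_deg (-1))" "\<And>zs v. length zs = length xs \<Longrightarrow> f zs v = 0"
  shows "pairing xs f v = 0"
  using assms
proof (induction xs arbitrary: f)
  case (Cons x xs)
  have "x = minus_part x"
    using Cons.prems(2) by (simp add: minus_part_L_deg)
  then have "ract zs x f v = 0" if "length zs = length xs" for zs v
    using ract_minus_part[OF Cons.prems(1), of zs x v] that Cons.prems(3) by simp
  then show ?case
    using Cons.IH[OF ract_test_fun[OF Cons.prems(1)]] Cons.prems(2) by simp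
qed simp

end

context module_projection begin

lemma null_Verma: "null_sp (Verma W) = cvec.span (ind_rel UNIV (L_ge 0) W)"
  by (simp add: Verma_def Ind_def)

lemma carrier_0: "0 \<in> carrier_sp W"
  using g_carrier[of 0] additive_scaleCD(3)[OF g_lin] by simp

lemma Verma_degree_pairing:
  assumes "u \<in> Verma_degree W k"
  obtains u' where "eq_in (Verma W) u u'"
    "u' \<in> cvec.span {tens xs v | xs v. xs \<in> lists (L_deg (-1)) \<and> length xs = k \<and> v \<in> carrier_sp W}"
  using assms unfolding Verma_degree_def by blast

lemma Psi_eq_in: "test_fun f \<Longrightarrow> eq_in (Verma W) u u' \<Longrightarrow> Psi f u = Psi f u'"
  using Psi_null[of f "u - u'"] by (simp add: eq_in_def additive_scaleC_diff[OF Psi_lin])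

lemma Psi_vanish:
  assumes u: "u \<in> Verma_degree W k" and f: "test_fun f" and "\<And>zs v. length zs = k \<Longrightarrow> f zs v = 0"
  shows "Psi f u = 0"
proof -
  obtain u' where u': "eq_in (Verma W) u u'"
    "u' \<in> cvec.span {tens xs v | xs v. xs \<in> lists (L_deg (-1)) \<and> length xs = k \<and> v \<in> carrier_sp W}"
    using u by (rule Verma_degree_pairing)
  have "Psi f u' = 0"
    by (rule additive_scaleC_span[OF Psi_lin _ u'(2)])
       (use assms(3) f in \<open>auto simp: Psi_tens intro!: pairing_vanish\<close>)
  then show ?thesis
    using Psi_eq_in[OF f u'(1)] by simp
qed

text \<open>A projection \<open>q\<close> whose kernel is the span of the relations makes every
  relation an exact equation. Hence \<open>q\<close> of a word is itself a legitimate test function,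
  and pairing a vector of pure degree with it returns \<open>q\<close> of that vector.\<close>

lemma Psi_separates:
  assumes u: "u \<in> Verma_degree W k"
    and 0: "\<And>f :: gen list \<Rightarrow> 'w \<Rightarrow> ((e44 list \<times> 'w) \<Rightarrow>\<^sub>0 complex). test_fun f \<Longrightarrow> Psi f u = 0"
  shows "u \<in> null_sp (Verma W)"
proof -
  let ?N = "null_sp (Verma W)"
  have N: "cvec.subspace ?N"
    by (simp add: null_Verma)
  obtain q where q_lin: "additive_scaleC q" and q_cong: "\<And>v. q v - v \<in> ?N"
    and q_null: "\<And>v. v \<in> ?N \<Longrightarrow> q v = 0"
    using quotient_projection[OF N cvec.subspace_UNIV subset_UNIV] by auto
  have q_rel: "q r = 0" if "r \<in> ind_rel UNIV (L_ge 0) W" for r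
    using that by (intro q_null) (simp add: null_Verma cvec.span_base)
  note q_simps = additive_scaleCD[OF q_lin] additive_scaleC_diff[OF q_lin]
  have q_alg: "q (tens (xs @ (c *\<^sub>C x + y) # ys) v) = c *\<^sub>C q (tens (xs @ x # ys) v)
      + q (tens (xs @ y # ys) v)"
    if "v \<in> carrier_sp W" for xs ys c x y v
    using q_rel[OF ind_rel.lin_alg[of xs UNIV ys x y v W c]] that by (simp add:
        q_simps algebra_simps)
  have q_mod: "q (tens xs (c *\<^sub>C u + v)) = c *\<^sub>C q (tens xs u) + q (tens xs v)"
    if "u \<in> carrier_sp W" "v \<in> carrier_sp W" for xs c u v
    using q_rel[OF ind_rel.lin_mod[of xs UNIV u W v c]] that by (simp add: q_simps algebra_simps)
  have q_env: "q (tens (xs @ x # y # ys) v) = super_sign p r *\<^sub>C q (tens (xs @ y # x # ys) v)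
      + q (tens (xs @ lie x y # ys) v)"
    if "v \<in> carrier_sp W" "x \<in> e44_part p" "y \<in> e44_part r" for xs ys x y p r v
    using q_rel[OF ind_rel.envelop[of xs UNIV ys x p y r v W]] that by (simp add:
        q_simps algebra_simps)
  have q_null_mod: "q (tens xs v) = 0" if "v \<in> null_sp W" for xs v
    using q_rel[OF ind_rel.null_mod[of xs UNIV v W]] that by simp
  have q_0: "q (tens xs 0) = 0" for xs
    using q_mod[OF carrier_0 carrier_0, of xs 1] by (simp add: scaleC_one)
  have q_alg0: "q (tens (xs @ 0 # ys) v) = 0" if "v \<in> carrier_sp W" for xs ys v
    using q_alg[OF that, of xs 1 0 0 ys] by (simp add: scaleC_one)
  define H where "H pre zs v = q (tens (pre @ map gen_elt zs) (g v))" for pre zs v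
    \<comment> \<open>The universal test function: \<open>H []\<close> represents the identity of the Verma module.\<close>
  have H_test_fun: "test_fun (H pre)" for pre
    unfolding test_fun_def
  proof (intro conjI allI)
    show "supersymmetric (H pre)"
      unfolding supersymmetric_def
    proof (intro allI)
      fix as z z' bs v
      show "H pre (as @ z # z' # bs) v = super_sign (gen_parity z) (gen_parity z') *\<^sub>C H pre
          (as @ z' # z # bs) v"
        using q_env[OF g_carrier gen_elt_part gen_elt_part, of "pre @ map gen_elt as"
            z z' "map gen_elt bs" v]
          q_alg0[OF g_carrier, of "pre @ map gen_elt as" "map gen_elt bs" v]
        by (simp add: H_def)
    qed
    show "additive_scaleC (H pre zs)" for zs
      using q_mod[OF g_carrier g_carrier, of _ 1] q_mod[OF g_carrier carrier_0]
      by (simp add: additive_scaleC_def H_def additive_scaleCD[OF g_lin] q_0 scaleC_one)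
  qed
  \<comment> \<open>This is what the prefix is for: an element of L_{-1} acting on
    \<open>H pre\<close> is absorbed at the end of \<open>pre\<close>, so the induction over the
    word closes.\<close>
  have H_act: "(\<lambda>zs. ract zs x (H pre)) = H (pre @ [x])" if "x \<in> L_deg (-1)" for x pre
  proof (intro ext)
    fix zs v
    have lin: "additive_scaleC (\<lambda>x. q (tens (pre @ x # map gen_elt zs) (g v)))"
      using q_alg[OF g_carrier, of pre 1 _ _ "map gen_elt zs"] q_alg[OF g_carrier, of pre _ _ 0
          "map gen_elt zs"]
      by (simp add: additive_scaleC_def scaleC_one q_alg0[OF g_carrier])
    have "ract zs x (H pre) v = (\<Sum>z\<in>UNIV. gen_coeff z x *\<^sub>C H pre (z # zs) v)"
      using ract_minus_part[OF H_test_fun, of zs x pre v] minus_part_L_deg[OF that] by simp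
    also have "\<dots> = q (tens (pre @ minus_part x # map gen_elt zs) (g v))"
      by (simp add: H_def minus_part_def additive_scaleC_sum[OF lin] additive_scaleCD(2)[OF lin])
    finally show "ract zs x (H pre) v = H (pre @ [x]) zs v"
      by (simp add: H_def minus_part_L_deg[OF that])
  qed
  have H_pairing: "pairing xs (H pre) v = q (tens (pre @ xs) (g v))" if "xs \<in> lists (L_deg (-1))"
      for xs pre v
    using that
  proof (induction xs arbitrary: pre)
    case (Cons x xs)
    then show ?case using H_act[of x pre] by simp
  qed (simp add: H_def)
  obtain u' where u': "eq_in (Verma W) u u'"
    "u' \<in> cvec.span {tens xs v | xs v. xs \<in> lists (L_deg (-1)) \<and> length xs = k \<and> v \<in> carrier_sp W}"
    using u by (rule Verma_degree_pairing)
  have "additive_scaleC (\<lambda>u. Psi (H []) u - q u)"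
    using Psi_lin[of "H []"] q_lin by (auto simp: additive_scaleC_def cvec.scale_right_diff_distrib)
  then have "Psi (H []) u' - q u' = 0"
  proof (rule additive_scaleC_span[OF _ _ u'(2)])
    fix s assume "s \<in> {tens xs v | xs v. xs \<in> lists (L_deg (-1)) \<and> length xs =
        k \<and> v \<in> carrier_sp W}"
    then obtain xs v where s: "s = tens xs v" "xs \<in> lists (L_deg (-1))" "v \<in> carrier_sp W" by blast
    have "q (tens xs (g v)) = q (tens xs v)"
      using q_mod[OF s(3), of "g v - v" xs 1] q_null_mod[OF g_cong[OF s(3)]] null_carrier
          g_cong[OF s(3)]
      by (auto simp: scaleC_one)
    then show "Psi (H []) s - q s = 0"
      using H_pairing[OF s(2), of "[]" "g v"] by (simp add: s Psi_tens g_idem)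
  qed
  then have "q u' = 0"
    using 0[OF H_test_fun[of "[]"]] Psi_eq_in[OF H_test_fun[of "[]"] u'(1)] by simp
  then have "u' \<in> ?N"
    using q_cong[of u'] cvec.subspace_neg[OF N, of "- u'"] by simp
  then show ?thesis
    using u'(1) cvec.subspace_add[OF N, of "u - u'" u'] by (simp add: eq_in_def)
qed

end

subsection \<open>Vector fields acting on test functions\<close>

fun evens :: "gen list \<Rightarrow> 4 list" where
  "evens [] = []"
| "evens (Partial i # zs) = i # evens zs"
| "evens (Dform i # zs) = evens zs"

fun odds :: "gen list \<Rightarrow> 4 list" where
  "odds [] = []"
| "odds (Partial i # zs) = odds zs"
| "odds (Dform i # zs) = i # odds zs"

lemma evens_append [simp]: "evens (xs @ ys) = evens xs @ evens ys"
  by (induction xs rule: evens.induct) simp_all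

lemma odds_append [simp]: "odds (xs @ ys) = odds xs @ odds ys"
  by (induction xs rule: odds.induct) simp_all

lemma evens_map [simp]: "evens (map Partial es) = es" "evens (map Dform ds) = []"
  by (induction es; simp) (induction ds; simp)

lemma odds_map [simp]: "odds (map Partial es) = []" "odds (map Dform ds) = ds"
  by (induction es; simp) (induction ds; simp)

lemma length_evens_odds: "length (evens zs) + length (odds zs) = length zs"
  by (induction zs rule: evens.induct) simp_all

text \<open>The divided power x^gamma / gamma!, with the exponent vector kept as a multiset: a
  derivative then removes one element and produces no coefficient.\<close>

definition dpower :: "4 multiset \<Rightarrow> pseries" where
  "dpower \<gamma> = Abs_fps (\<lambda>d. Abs_fps (\<lambda>c. Abs_fps (\<lambda>b. Abs_fps (\<lambda>a.
     if a = count \<gamma> 1 \<and> b = count \<gamma> 2 \<and> c = count \<gamma> 3 \<and> d = count \<gamma> 4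
     then 1 / (fact a * fact b * fact c * fact d) else 0))))"

lemma coeff4_dpower:
  "coeff4 (dpower \<gamma>) m = (if \<forall>i. m $ i = count \<gamma> i
     then 1 / (fact (m $ 1) * fact (m $ 2) * fact (m $ 3) * fact (m $ 4)) else 0)"
  by (simp add: coeff4_def dpower_def forall_4)

lemma dpower_empty: "dpower {#} = 1"
  by (rule coeff4_eqI) (auto simp: coeff4_dpower coeff4_1 vec_eq_iff)

lemma pdiff_dpower: "pdiff i (dpower \<gamma>) = (if i \<in># \<gamma> then dpower (\<gamma> - {#i#}) else 0)"
proof (cases "i \<in># \<gamma>")
  case True
  then obtain \<delta> where \<gamma>: "\<gamma> = add_mset i \<delta>" by (metis insert_DiffM)
  have "coeff4 (pdiff i (dpower \<gamma>)) m = coeff4 (dpower \<delta>) m" for m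
    using exhaust_4[of i]
    by (elim disjE) (simp_all add: coeff4_pdiff coeff4_dpower \<gamma> forall_4 axis_nth field_simps del:
        of_nat_Suc)
  then show ?thesis using True by (simp add: \<gamma> coeff4_eqI)
next
  case False
  have "coeff4 (pdiff i (dpower \<gamma>)) m = 0" for m
    using exhaust_4[of i] False
    by (elim disjE) (auto simp: coeff4_pdiff coeff4_dpower forall_4 axis_nth not_in_iff)
  then show ?thesis using False by (simp add: coeff4_eqI coeff4_0)
qed

lemma fold_pdiff_0: "fold pdiff es 0 = 0"
  by (induction es) simp_all

lemma fold_pdiff_dpower:
  "fold pdiff es (dpower \<gamma>) = (if mset es \<subseteq># \<gamma> then dpower (\<gamma> - mset es) else 0)"
proof (induction es arbitrary: \<gamma>)
  case (Cons e es)
  show ?case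
  proof (cases "e \<in># \<gamma>")
    case True
    then obtain \<delta> where "\<gamma> = add_mset e \<delta>" by (metis insert_DiffM)
    then show ?thesis by (simp add: pdiff_dpower Cons.IH)
  next
    case False
    then show ?thesis
      by (auto simp: pdiff_dpower fold_pdiff_0 dest: mset_subset_eqD)
  qed
qed simp

lemma sum_count_UNIV: "(\<Sum>k\<in>UNIV. count \<gamma> k) = size (\<gamma> :: 'a::finite multiset)"
  unfolding size_multiset_overloaded_eq
  by (rule sum.mono_neutral_right) (auto simp: not_in_iff)

lemma vfield_dpower_L_ge: "n + 1 \<le> size \<gamma> \<Longrightarrow> vfield (dpower \<gamma>) k \<in> L_ge (int n)"
proof -
  assume n: "n + 1 \<le> size \<gamma>"
  have "int n + 1 \<le> int (\<Sum>k\<in>UNIV. m $ k)" if "coeff4 (fst (vfield (dpower \<gamma>) k) $ i) m \<noteq> 0" for i m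
    using that n
    by (auto simp: vfield_def axis_nth coeff4_dpower coeff4_0 simp del: of_nat_sum simp flip:
        sum_count_UNIV split: if_splits)
  then show ?thesis
    unfolding L_ge_def by (auto simp: vfield_def coeff4_0)
qed

lemma vfield_part: "vfield h k \<in> e44_part 0"
  by (simp add: e44_part_def vfield_def)

lemma vfield_0: "vfield 0 k = 0"
  by (simp add: vfield_def zero_prod_def vec_eq_iff axis_nth)

lemma lie_vfield_Partial: "lie (vfield h k) (gen_elt (Partial i)) = - vfield (pdiff i h) k"
  unfolding lie_Partial by (simp add: vfield_def prod_eq_iff vec_eq_iff axis_nth)

lemma e44_part_twist: "x \<in> e44_part q \<Longrightarrow> twist p x \<in> e44_part q"
  by (simp add: twist_homogeneous e44_part_scaleC)

context nonneg_rep begin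

lemma ract_0: "test_fun f \<Longrightarrow> ract zs 0 f v = 0"
  using ract_scaleC[of f zs 0 0 v] by (simp add: test_fun_def)

lemma ract_minus: "test_fun f \<Longrightarrow> ract zs (- x) f v = - ract zs x f v"
  using ract_scaleC[of f zs "-1" x v] by (simp add: test_fun_def scaleC_one)

lemma ract_zero_fun: "(\<And>l v. f l v = 0) \<Longrightarrow> ract zs x f v = 0"
  using ract_fun_scaleC[of zs x 0 f v] by (simp add: fun_eq_iff) (metis ext)

section \<open>Normal form of words, and the number of odd letters\<close>

lemma test_fun_append: "test_fun f \<Longrightarrow> test_fun (\<lambda>l. f (zs @ l))"
  by (induction zs arbitrary: f) (auto dest: test_fun_Cons)

lemma test_fun_move_even:
  assumes "test_fun f" "gen_parity z = 0"
  shows "f (zs @ z # l) v = f (z # zs @ l) v"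
  using assms(1)
proof (induction zs arbitrary: f)
  case (Cons y zs)
  have "f (y # zs @ z # l) v = f (y # z # zs @ l) v"
    by (rule Cons.IH[OF test_fun_Cons[OF Cons.prems]])
  also have "\<dots> = f (z # y # zs @ l) v"
    using test_fun_swap[OF Cons.prems, of "[]" y z] by (simp add: assms(2) scaleC_one)
  finally show ?case by simp
qed simp

lemma test_fun_move_odd: "test_fun f \<Longrightarrow> f (Dform i # map Partial es @ l) v =
    f (map Partial es @ Dform i # l) v"
proof (induction es arbitrary: f)
  case (Cons e es)
  then show ?case
    using test_fun_move_even[OF Cons.prems, of "Partial e" "[Dform i]" "map Partial es @ l"]
      Cons.IH[OF test_fun_Cons[OF Cons.prems], of "Partial e"]
    by simp
qed simp

text \<open>No sign appears, because only even letters move and the odd ones keep their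
  order.\<close>

lemma test_fun_reorder:
  assumes "test_fun f"
  shows "f zs v = f (map Partial (evens zs) @ map Dform (odds zs)) v"
  using assms
proof (induction zs arbitrary: f rule: evens.induct)
  case (2 i zs)
  then show ?case using "2.IH"[OF test_fun_Cons[OF "2.prems"], of "Partial i"] by simp
next
  case (3 i zs)
  show ?case using "3.IH"[OF test_fun_Cons[OF "3.prems"], of "Dform i"] test_fun_move_odd[OF
      "3.prems"] by simp
qed simp

lemma test_fun_permute_evens:
  assumes "test_fun f" "mset es = mset es'"
  shows "f (map Partial es @ l) v = f (map Partial es' @ l) v"
  using assms
proof (induction es arbitrary: es' f)
  case (Cons e es)
  then have "e \<in> set es'" by (metis list.set_intros(1) mset_eq_setD)
  then obtain a b where es': "es' = a @ e # b" by (meson split_list)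
  then have "f (map Partial (e # es) @ l) v = f (Partial e # map Partial (a @ b) @ l) v"
    using Cons.IH[OF test_fun_Cons[OF Cons.prems(1)], of "a @ b" "Partial e"] Cons.prems(2) by simp
  also have "\<dots> = f (map Partial es' @ l) v"
    using test_fun_move_even[OF Cons.prems(1), of "Partial e" "map Partial a" "map Partial b @ l"
        v] by (simp add: es')
  finally show ?case .
qed simp

lemma eq_neg_self: "x = - x \<Longrightarrow> x = (0 :: 'b::complex_vec)"
proof -
  assume "x = - x"
  then have "2 *\<^sub>C x = 0"
    using scaleC_add_left[of 1 1 x] by (simp add: scaleC_one eq_neg_iff_add_eq_0)
  then show "x = 0" by simp
qed

lemma test_fun_repeated_odd:
  assumes "test_fun f"
  shows "f (as @ Dform x # map Dform b @ Dform x # l) v = 0"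
  using assms
proof (induction b arbitrary: as)
  case Nil
  then show ?case
    using test_fun_swap[OF Nil, of as "Dform x" "Dform x" l v] by (intro eq_neg_self) (simp add:
        scaleC_one)
next
  case (Cons y b)
  then show ?case
    using test_fun_swap[OF Cons.prems, of as "Dform x" "Dform y" "map Dform b @ Dform x # l" v]
      Cons.IH[OF Cons.prems, of "as @ [Dform y]"] by simp
qed

text \<open>More than four letters d_j repeat an index, and exchanging two equal odd letters gives f
  = -f. This is the 4 in the bound 5 = 4 + 1.\<close>

lemma test_fun_many_odd:
  assumes "test_fun f" "4 < length (odds zs)"
  shows "f zs v = 0"
proof -
  have "\<not> distinct (odds zs)"
    using assms(2) card_mono[OF finite subset_UNIV, of "set (odds zs)"] distinct_card[of "odds zs"]
    by auto
  then obtain a x b c where "odds zs = a @ [x] @ b @ [x] @ c"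
    using not_distinct_decomp by blast
  then show ?thesis
    using test_fun_reorder[OF assms(1), of zs v] test_fun_repeated_odd[OF assms(1), of
        "map Partial (evens zs) @ map Dform a" x b "map Dform c" v]
    by simp
qed

text \<open>The dual form of the statement that even elements never raise the number of letters d_j,
  while odd ones raise it by at most one. A bracket with d_j uses up that letter and flips the
  parity, so the two claims need a common induction.\<close>

lemma ract_low_odd:
  assumes "\<And>zs v. length (odds zs) \<noteq> i \<Longrightarrow> f zs v = 0"
  shows "(y \<in> e44_part 0 \<longrightarrow> length (odds zs) < i \<longrightarrow> ract zs y f v = 0) \<and>
    (y \<in> e44_part 1 \<longrightarrow> length (odds zs) + 1 < i \<longrightarrow> ract zs y f v = 0)"
  using assms
proof (induction zs arbitrary: i f y)
  case Nil
  have "gen_coeff z y *\<^sub>C f [z] v = 0" if "y \<in> e44_part 0 \<and> 0 < i \<or> y \<in> e44_part 1 \<and> 1 < i" for z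
    using that Nil[of "[z]" v] gen_coeff_homogeneous[of y _ z] by (cases z) auto
  then show ?case using Nil[of "[]"] by (auto intro!: sum.neutral)
next
  case (Cons z zs)
  show ?case
  proof (cases z)
    case (Partial j)
    have f': "\<And>zs v. length (odds zs) \<noteq> i \<Longrightarrow> f (Partial j # zs) v = 0"
      using Cons.prems by simp
    have "lie y (gen_elt (Partial j)) \<in> e44_part p" if "y \<in> e44_part p" for p
      using e44_part_lie[OF that gen_elt_part[of "Partial j"]] by simp
    then show ?thesis
      using Cons.IH[of i f "lie y (gen_elt z)", OF Cons.prems] Cons.IH[of i
          "\<lambda>l. f (Partial j # l)" y, OF f'] Partial by auto
  next
    case (Dform j)
    \<comment> \<open>The prefix \<open>Dform j\<close> lowers the level by one; for
      \<open>i = 0\<close> both claims are void.\<close>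
    have f': "\<And>zs v. length (odds zs) \<noteq> i - 1 \<Longrightarrow> f (Dform j # zs) v = 0" if "i \<noteq> 0"
      using Cons.prems that by simp
    have part: "y \<in> e44_part 0 \<Longrightarrow> lie y (gen_elt (Dform j)) \<in> e44_part 1"
      "y \<in> e44_part 1 \<Longrightarrow> lie y (gen_elt (Dform j)) \<in> e44_part 0"
      using e44_part_lie[OF _ gen_elt_part[of "Dform j"], of y 0] e44_part_lie[OF _
          gen_elt_part[of "Dform j"], of y 1]
      by (simp_all del: gen_elt.simps)
    show ?thesis
      using part Cons.IH[of i f "lie y (gen_elt z)", OF Cons.prems] Cons.IH[of "i - 1"
          "\<lambda>l. f (Dform j # l)" "twist 1 y", OF f']
        Dform e44_part_twist[of y 0 1] e44_part_twist[of y 1 1]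
      by (simp del: gen_elt.simps)
  qed
qed

text \<open>No letter partial_e may survive into \<open>f\<close>, so each is consumed by a bracket,
  which differentiates the coefficient and changes the sign.\<close>

lemma ract_evens_0:
  assumes f: "test_fun f" and "\<And>zs v. evens zs \<noteq> [] \<Longrightarrow> f zs v = 0"
  shows "ract (map Partial es @ os) (vfield h k) f v = (-1) ^ length es *\<^sub>C ract os
      (vfield (fold pdiff es h) k) f v"
proof (induction es arbitrary: h)
  case (Cons e es)
  have "ract l (vfield h k) (\<lambda>l. f (Partial e # l)) v = 0" for l
    by (rule ract_zero_fun) (simp add: assms(2))
  then show ?case
    using Cons.IH by (simp add: lie_vfield_Partial ract_minus[OF f] del: gen_elt.simps)
qed (simp add: scaleC_one)

text \<open>Either all letters partial_e are consumed, or exactly one partial_k survives into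
  \<open>f\<close>. The latter can happen in \<open>count (mset es) k\<close> ways and uses one
  bracket less, whence the relative minus sign.\<close>

lemma ract_evens_1:
  assumes f: "test_fun f" and supp: "\<And>zs v. evens zs \<noteq> [k] \<Longrightarrow> f zs v = 0"
  shows "ract (map Partial es @ os) (vfield h k) f v = (-1) ^ length es *\<^sub>C
    (ract os (vfield (fold pdiff es h) k) f v - of_nat (count (mset es) k) *\<^sub>C
      ract os (vfield (fold pdiff (remove1 k es) h) k) (\<lambda>l. f (Partial k # l)) v)"
proof (induction es arbitrary: h)
  case (Cons e es)
  let ?f = "\<lambda>l. f (Partial k # l)" and ?R = "\<lambda>h. ract os (vfield h k)"
  have first: "ract (map Partial es @ os) (lie (vfield h k) (gen_elt (Partial e))) f v
      = (-1) ^ length (e # es) *\<^sub>C (?R (fold pdiff (e # es) h) f v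
        - of_nat (count (mset es) k) *\<^sub>C ?R (fold pdiff (remove1 k es) (pdiff e h)) ?f v)"
    by (simp add: lie_vfield_Partial ract_minus[OF f] Cons.IH del: gen_elt.simps)
  show ?case
  proof (cases "e = k")
    case True
    have second: "ract (map Partial es @ os) (vfield h k) ?f v = (-1) ^ length es *\<^sub>C ?R
        (fold pdiff es h) ?f v"
      by (rule ract_evens_0[OF test_fun_Cons[OF f]]) (simp add: supp)
    \<comment> \<open>Derivatives commute, so the removed \<open>k\<close> can be restored; if
      \<open>es\<close> contains no \<open>k\<close>, the coefficient is zero.\<close>
    have "of_nat (count (mset es) k) *\<^sub>C ?R (fold pdiff (remove1 k es) (pdiff k h)) ?f v
        = of_nat (count (mset es) k) *\<^sub>C ?R (fold pdiff es h) ?f v"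
    proof (cases "k \<in> set es")
      case True
      then have "fold pdiff (k # remove1 k es) h = fold pdiff es h"
        by (intro fun_cong[OF fold_multiset_equiv]) (auto simp: fun_eq_iff pdiff_commute)
      then show ?thesis by simp
    next
      case False
      then have "count (mset es) k = 0" by (simp add: count_eq_zero_iff)
      then show ?thesis by simp
    qed
    then show ?thesis
      using first second True
      by (simp add: scaleC_add_left scaleC_one scaleC_add_right cvec.scale_right_diff_distrib
          algebra_simps del: gen_elt.simps)
  next
    case False
    have "ract (map Partial es @ os) (vfield h k) (\<lambda>l. f (Partial e # l)) v = 0"
      by (rule ract_zero_fun) (simp add: supp False)
    then show ?thesis
      using first False by (simp del: gen_elt.simps)
  qed
qed (simp add: scaleC_one)

lemma test_funI:
  assumes "\<And>as z z' bs v. f (as @ z # z' # bs) v =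
      super_sign (gen_parity z) (gen_parity z') *\<^sub>C f (as @ z' # z # bs) v"
    and "\<And>zs. additive_scaleC (f zs)"
  shows "test_fun f"
  using assms unfolding test_fun_def supersymmetric_def by blast

lemma test_fun_length:
  assumes "test_fun f"
  shows "test_fun (\<lambda>l v. if length l = n then f l v else 0)"
proof (rule test_funI)
  show "(if length (as @ z # z' # bs) = n then f (as @ z # z' # bs) v else 0) =
      super_sign (gen_parity z) (gen_parity z') *\<^sub>C
      (if length (as @ z' # z # bs) = n then f (as @ z' # z # bs) v else 0)" for as z z' bs v
    using test_fun_swap[OF assms, of as z z' bs v] by simp
  show "additive_scaleC (\<lambda>v. if length zs = n then f zs v else 0)" for zs
    using test_fun_lin[OF assms, of zs] by (simp add: additive_scaleC_def)
qed

text \<open>Dual to the monomial partial^gamma: paired with a vector it applies \<open>f\<close> to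
  the coefficient at that monomial, an element of Lambda(d_1,...,d_4) (x) W.\<close>

definition extend :: "4 multiset \<Rightarrow> (gen list \<Rightarrow> 'w \<Rightarrow> 'u::complex_vec) \<Rightarrow> gen list \<Rightarrow> 'w \<Rightarrow> 'u" where
  "extend \<gamma> f zs v = (if mset (evens zs) = \<gamma> then f (map Dform (odds zs)) v else 0)"

lemma test_fun_extend:
  assumes "test_fun f"
  shows "test_fun (extend \<gamma> f)"
  unfolding test_fun_def
proof (intro conjI allI)
  show "supersymmetric (extend \<gamma> f)"
    unfolding supersymmetric_def
  proof (intro allI)
    fix as z z' bs v
    show "extend \<gamma> f (as @ z # z' # bs) v = super_sign (gen_parity z) (gen_parity z') *\<^sub>C extend \<gamma>
        f (as @ z' # z # bs) v"
      by (cases z; cases z')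
         (use test_fun_swap[OF assms, of "map Dform (odds as)" z z' "map Dform (odds bs)" v]
          in \<open>auto simp: extend_def scaleC_one add_mset_commute\<close>)
  qed
  show "additive_scaleC (extend \<gamma> f zs)" for zs
    using test_fun_lin[OF assms, of "map Dform (odds zs)"] by (auto simp:
        extend_def additive_scaleC_def)
qed

lemma test_fun_add:
  assumes "test_fun f" "test_fun h"
  shows "test_fun (\<lambda>l v. f l v + h l v)"
proof (rule test_funI)
  show "f (as @ z # z' # bs) v + h (as @ z # z' # bs) v = super_sign (gen_parity z)
      (gen_parity z') *\<^sub>C
      (f (as @ z' # z # bs) v + h (as @ z' # z # bs) v)" for as z z' bs v
    using test_fun_swap[OF assms(1), of as z z' bs v] test_fun_swap[OF assms(2), of as z z' bs v]
    by (simp add: scaleC_add_right)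
  show "additive_scaleC (\<lambda>v. f zs v + h zs v)" for zs
    using test_fun_lin[OF assms(1), of zs] test_fun_lin[OF assms(2), of zs]
    by (simp add: additive_scaleC_def scaleC_add_right)
qed

lemma test_fun_scaleC:
  assumes "test_fun f"
  shows "test_fun (\<lambda>l v. c *\<^sub>C f l v)"
proof (rule test_funI)
  show "c *\<^sub>C f (as @ z # z' # bs) v = super_sign (gen_parity z) (gen_parity z') *\<^sub>C
      c *\<^sub>C f (as @ z' # z # bs) v" for as z z' bs v
    using test_fun_swap[OF assms, of as z z' bs v] by (simp add: scaleC_scaleC mult.commute)
  show "additive_scaleC (\<lambda>v. c *\<^sub>C f zs v)" for zs
    using test_fun_lin[OF assms, of zs] by (simp add: additive_scaleC_def scaleC_add_right
        scaleC_scaleC mult.commute)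
qed

lemma test_fun_0: "test_fun (\<lambda>l v. 0)"
  by (simp add: test_fun_def supersymmetric_def additive_scaleC_def)

lemma test_fun_sum: "(\<And>\<gamma>. \<gamma> \<in> \<Gamma> \<Longrightarrow> test_fun (f \<gamma>)) \<Longrightarrow> test_fun (\<lambda>l v. \<Sum>\<gamma>\<in>\<Gamma>. f \<gamma> l v)"
  by (induction \<Gamma> rule: infinite_finite_induct) (simp_all add: test_fun_0 test_fun_add)

end

context module_projection begin

subsection \<open>Singular vectors\<close>

lemma Psi_fun_add: "Psi (\<lambda>l v. f l v + h l v) u = Psi f u + Psi h u"
  unfolding Psi_def by (simp add: pairing_fun_add case_prod_unfold flip: lin_ext_add)

lemma Psi_fun_scaleC: "Psi (\<lambda>l v. c *\<^sub>C f l v) u = c *\<^sub>C Psi f u"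
  unfolding Psi_def by (simp add: pairing_fun_scaleC case_prod_unfold flip: lin_ext_scaleC)

lemma Psi_fun_0: "Psi (\<lambda>l v. 0) u = 0"
  using Psi_fun_scaleC[of 0 "\<lambda>l v. 0" u] by simp

lemma Psi_fun_sum: "Psi (\<lambda>l v. \<Sum>\<gamma>\<in>\<Gamma>. f \<gamma> l v) u = (\<Sum>\<gamma>\<in>\<Gamma>. Psi (f \<gamma>) u)"
  by (induction \<Gamma> rule: infinite_finite_induct) (simp_all add: Psi_fun_0 Psi_fun_add)

lemma test_fun_diff: "test_fun f \<Longrightarrow> test_fun h \<Longrightarrow> test_fun (\<lambda>l v. f l v - h l v)"
  using test_fun_add[OF _ test_fun_scaleC[of h "-1"], of f] by (simp add: scaleC_one)

lemma Psi_fun_diff: "Psi (\<lambda>l v. f l v - h l v) u = Psi f u - Psi h u"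
  using Psi_fun_add[of f "\<lambda>l v. (-1) *\<^sub>C h l v" u] Psi_fun_scaleC[of "-1" h u] by (simp add:
      scaleC_one)

text \<open>The component of \<open>u\<close> at a monomial with \<open>i'\<close> factors \<open>d\<^sub>j\<close> and exponent \<open>p'\<close> of \<open>\<partial>\<^sub>1\<close>
  vanishes if \<open>(i', p') \<ge> (i, p)\<close> lexicographically.  The argument \<open>T\<close> only fixes the
  type of values of test functions.\<close>

definition components_vanish_from :: "((e44 list \<times> 'w) \<Rightarrow>\<^sub>0 complex) \<Rightarrow> nat \<Rightarrow> nat \<Rightarrow> nat \<Rightarrow>
    'u::complex_vec itself \<Rightarrow> bool" where
  "components_vanish_from u k i p T \<longleftrightarrow> (\<forall>f :: gen list \<Rightarrow> 'w \<Rightarrow> 'u. test_fun f \<longrightarrow>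
    (\<forall>zs v. length zs = k \<longrightarrow>
      length (odds zs) < i \<or> length (odds zs) = i \<and> count (mset (evens zs)) 1 < p \<longrightarrow> f zs v = 0) \<longrightarrow>
    Psi f u = 0)"

section \<open>One step of the double induction\<close>

context
  fixes u k i p and T :: "'u::complex_vec itself"
  assumes singular: "\<And>x. x \<in> L_ge 1 \<Longrightarrow> act (Verma W) x u \<in> null_sp (Verma W)"
    and ik: "i + 2 \<le> k"
    and next_level: "components_vanish_from u k i (Suc p) T"
begin

text \<open>Applying \<open>next_level\<close> to the difference shows that a test function matters
  only through its values on words whose components are not yet known to vanish.\<close>

lemma Psi_eqI:
  fixes f h :: "gen list \<Rightarrow> 'w \<Rightarrow> 'u"
  assumes "test_fun f" "test_fun h"
    and "\<And>zs v. \<lbrakk>length zs = k; length (odds zs) < i\<rbrakk> \<Longrightarrow> f zs v = h zs v"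
    and "\<And>zs v. \<lbrakk>length zs = k; length (odds zs) = i; count (mset (evens zs)) 1 \<le> p\<rbrakk> \<Longrightarrow> f zs v =
        h zs v"
  shows "Psi f u = Psi h u"
proof -
  have "Psi (\<lambda>l v. f l v - h l v) u = 0"
    using next_level assms unfolding components_vanish_from_def
    by (elim allE impE) (auto intro!: test_fun_diff simp: less_Suc_eq_le)
  then show ?thesis
    by (simp add: Psi_fun_diff)
qed

context
  fixes F :: "gen list \<Rightarrow> 'w \<Rightarrow> 'u" and \<gamma> :: "4 multiset"
  assumes F: "test_fun F" and F_supp: "\<And>zs v. evens zs = [] \<Longrightarrow> length (odds zs) \<noteq> i \<Longrightarrow> F zs v = 0"
    and \<gamma>: "size \<gamma> = k - i" "count \<gamma> 1 = p"
begin

text \<open>\<open>F0\<close> and \<open>F1\<close> read off the components of a vector without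
  partial derivatives and with a single partial_1. As \<open>dpower {#1#}\<close> is x_1,
  \<open>EF\<close> is \<open>F0\<close> acted on by E.\<close>

abbreviation "F0 \<equiv> extend {#} F"
abbreviation "F1 \<equiv> extend {#1#} F"
abbreviation "EF \<equiv> (\<lambda>zs. ract zs (vfield (dpower {#1#}) 1) F0)"

lemma extend_supp: "length (odds zs) \<noteq> i \<Longrightarrow> extend \<delta> F zs v = 0"
  by (simp add: extend_def F_supp)

lemma extend_low: "length zs = k \<Longrightarrow> length (odds zs) < i \<Longrightarrow> extend \<gamma> h zs v = 0"
  using length_evens_odds[of zs] \<gamma> ik by (auto simp: extend_def simp flip: size_mset)

lemma ract_extend_low: "length (odds zs) < i \<Longrightarrow> ract zs (vfield h 1) (extend \<delta> F) v = 0"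
  using ract_low_odd[of i "extend \<delta> F" "vfield h 1" zs v] extend_supp vfield_part by blast

lemma Psi_vfield:
  assumes "test_fun f" "2 \<le> size \<delta>"
  shows "Psi (\<lambda>zs. ract zs (vfield (dpower \<delta>) 1) f) u = 0"
proof -
  have "vfield (dpower \<delta>) 1 \<in> L_ge 1"
    using vfield_dpower_L_ge[of 1 \<delta>] assms(2) by simp
  then show ?thesis
    using Psi_null[OF assms(1) singular] Psi_act[of f "vfield (dpower \<delta>) 1" u] by simp
qed

text \<open>By size, \<open>es\<close> would be gamma + e_1 - e_l. For l = 1 this is gamma itself;
  for any other l the exponent of partial_1 is p + 1, too large.\<close>

lemma not_subset:
  assumes "size es = k - i" "count es 1 \<le> p" "es \<noteq> \<gamma>"
  shows "\<not> es \<subseteq># add_mset 1 \<gamma>"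
proof
  assume "es \<subseteq># add_mset 1 \<gamma>"
  then have r: "add_mset 1 \<gamma> = es + (add_mset 1 \<gamma> - es)" (is "_ = _ + ?r")
    by (simp only: subset_mset.add_diff_inverse)
  have "size (add_mset 1 \<gamma>) = size (es + ?r)" using r by (rule arg_cong)
  then have "size ?r = 1" using assms(1) \<gamma>(1) by (simp only: size_add_mset size_union)
  then obtain l where l: "?r = {#l#}" by (rule size_1_singleton_mset[THEN exE])
  have r': "add_mset 1 \<gamma> = add_mset l es"
    using r unfolding l by simp
  have "l = 1"
  proof (rule ccontr)
    assume "l \<noteq> 1"
    then have "count (add_mset l es) 1 = count es 1" by simp
    then show False using assms(2) \<gamma>(2) unfolding r'[symmetric] by simp
  qed
  then show False using r' assms(3) by simp
qed

lemma test_fun_EF: "test_fun EF"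
  by (intro ract_test_fun test_fun_extend F)

text \<open>All partial derivatives are consumed by x^(gamma+e_1). On the words considered,
  \<open>not_subset\<close> leaves only the exponent gamma, and then the coefficient that remains is
  x_1.\<close>

lemma ract_F0:
  assumes "length zs = k" "length (odds zs) = i" "count (mset (evens zs)) 1 \<le> p"
  shows "ract zs (vfield (dpower (add_mset 1 \<gamma>)) 1) F0 v = (-1) ^ (k - i) *\<^sub>C extend \<gamma> EF zs v"
proof -
  let ?es = "evens zs" and ?ds = "odds zs"
  have es: "length ?es = k - i"
    using length_evens_odds[of zs] assms by simp
  have "ract zs (vfield (dpower (add_mset 1 \<gamma>)) 1) F0 v
      = ract (map Partial ?es @ map Dform ?ds) (vfield (dpower (add_mset 1 \<gamma>)) 1) F0 v"
    by (rule test_fun_reorder[OF ract_test_fun[OF test_fun_extend[OF F]]])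
  also have "\<dots> = (-1) ^ (k - i) *\<^sub>C ract (map Dform ?ds)
      (vfield (fold pdiff ?es (dpower (add_mset 1 \<gamma>))) 1) F0 v"
    by (subst ract_evens_0) (simp_all add: test_fun_extend F es extend_def)
  also have "\<dots> = (-1) ^ (k - i) *\<^sub>C extend \<gamma> EF zs v"
    using not_subset[of "mset ?es"] assms(3) es
    by (auto simp: fold_pdiff_dpower extend_def vfield_0 ract_0 test_fun_extend F)
  finally show ?thesis .
qed

lemma Psi_extend_EF: "Psi (extend \<gamma> EF) u = 0"
proof -
  have "Psi (\<lambda>zs. ract zs (vfield (dpower (add_mset 1 \<gamma>)) 1) F0) u =
      Psi (\<lambda>zs v. (-1) ^ (k - i) *\<^sub>C extend \<gamma> EF zs v) u"
    by (rule Psi_eqI)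
       (simp_all add: ract_test_fun test_fun_extend F test_fun_scaleC test_fun_EF ract_extend_low
           extend_low ract_F0)
  moreover have "Psi (\<lambda>zs. ract zs (vfield (dpower (add_mset 1 \<gamma>)) 1) F0) u = 0"
    by (rule Psi_vfield) (use \<gamma> ik in \<open>simp_all add: test_fun_extend F\<close>)
  ultimately show ?thesis
    by (simp add: Psi_fun_scaleC)
qed

lemma not_subset_remove1:
  assumes "size es = k - i" "count es 1 \<le> p" "es \<noteq> \<gamma>" "1 \<in># es"
  shows "\<not> es - {#1#} \<subseteq># \<gamma>"
proof -
  have "add_mset 1 (es - {#1#}) = es"
    using assms(4) by (rule insert_DiffM)
  then show ?thesis
    using not_subset[OF assms(1-3)] mset_subset_eq_add_mset_cancel[of 1 "es - {#1#}" \<gamma>] by simp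
qed

text \<open>Two contributions from \<open>ract_evens_1\<close>: if all derivatives are consumed by
  x^gamma, the field partial_1 remains and is the letter that \<open>F1\<close> asks for; if one of
  the p letters partial_1 survives, x_1 partial_1 remains and acts on \<open>F0\<close>.\<close>

lemma ract_F1:
  assumes "length zs = k" "length (odds zs) = i" "count (mset (evens zs)) 1 \<le> p"
  shows "ract zs (vfield (dpower \<gamma>) 1) F1 v =
    (-1) ^ (k - i) *\<^sub>C (extend \<gamma> F zs v - of_nat p *\<^sub>C extend \<gamma> EF zs v)"
proof -
  let ?es = "evens zs" and ?ds = "odds zs"
  have es: "size (mset ?es) = k - i"
    using length_evens_odds[of zs] assms by simp
  have F1: "(\<lambda>l. F1 (Partial 1 # l)) = F0"
    by (simp add: fun_eq_iff extend_def)
  have "ract zs (vfield (dpower \<gamma>) 1) F1 v = ract (map Partial ?es @ map Dform ?ds)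
      (vfield (dpower \<gamma>) 1) F1 v"
    by (rule test_fun_reorder[OF ract_test_fun[OF test_fun_extend[OF F]]])
  also have "\<dots> = (-1) ^ (k - i) *\<^sub>C (ract (map Dform ?ds) (vfield (fold pdiff ?es (dpower \<gamma>)) 1)
      F1 v
      - of_nat (count (mset ?es) 1) *\<^sub>C ract (map Dform ?ds) (vfield (fold pdiff (remove1 1 ?es)
          (dpower \<gamma>)) 1) F0 v)"
    using es by (subst ract_evens_1) (auto simp: test_fun_extend F extend_def F1)
  also have "ract (map Dform ?ds) (vfield (fold pdiff ?es (dpower \<gamma>)) 1) F1 v = extend \<gamma> F zs v"
  proof (cases "mset ?es = \<gamma>")
    case True
    then show ?thesis
      using ract_gen[OF test_fun_extend[OF F], of "map Dform ?ds" "Partial 1" "{#1#}" v]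
      by (simp add: fold_pdiff_dpower dpower_empty extend_def)
  next
    case False
    have "mset ?es \<subseteq># add_mset 1 \<gamma>" if "mset ?es \<subseteq># \<gamma>"
      using that by (rule subset_mset.order_trans) simp
    then have "\<not> mset ?es \<subseteq># \<gamma>"
      using not_subset[OF es assms(3) False] by (rule contrapos_nn[rotated])
    then show ?thesis
      using False by (simp add: fold_pdiff_dpower extend_def vfield_0 ract_0 test_fun_extend F)
  qed
  also have "of_nat (count (mset ?es) 1) *\<^sub>C ract (map Dform ?ds)
      (vfield (fold pdiff (remove1 1 ?es) (dpower \<gamma>)) 1) F0 v
      = of_nat p *\<^sub>C extend \<gamma> EF zs v"
  proof (cases "1 \<in># mset ?es")
    case True
    show ?thesis
    proof (cases "mset ?es = \<gamma>")
      case es_\<gamma>: True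
      then have "add_mset 1 (\<gamma> - {#1#}) = \<gamma>"
        using True by (simp only: insert_DiffM)
      then have "\<gamma> - (\<gamma> - {#1#}) = {#1#}"
        by (metis add_diff_cancel_left' add_mset_add_single)
      then show ?thesis
        using es_\<gamma> True \<gamma>(2) by (simp add: fold_pdiff_dpower extend_def)
    next
      case False
      then show ?thesis
        using not_subset_remove1[OF es assms(3) False True]
        by (simp add: fold_pdiff_dpower extend_def vfield_0 ract_0 test_fun_extend F)
    qed
  next
    case False
    then have "count (mset ?es) 1 = 0" by (simp add: count_eq_zero_iff)
    \<comment> \<open>A word with exponent gamma has p = 0 here, and for all other words
      \<open>extend\<close> vanishes.\<close>
    then show ?thesis using \<gamma>(2) by (auto simp: extend_def)
  qed
  finally show ?thesis .
qed

lemma Psi_extend: "Psi (extend \<gamma> F) u = 0"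
proof -
  let ?h = "\<lambda>zs v. (-1) ^ (k - i) *\<^sub>C (extend \<gamma> F zs v - of_nat p *\<^sub>C extend \<gamma> EF zs v)"
  have "Psi (\<lambda>zs. ract zs (vfield (dpower \<gamma>) 1) F1) u = Psi ?h u"
    by (rule Psi_eqI)
       (simp_all add: ract_test_fun test_fun_extend F test_fun_scaleC test_fun_EF test_fun_diff
           ract_extend_low extend_low ract_F1)
  moreover have "Psi (\<lambda>zs. ract zs (vfield (dpower \<gamma>) 1) F1) u = 0"
    by (rule Psi_vfield) (use \<gamma> ik in \<open>simp_all add: test_fun_extend F\<close>)
  ultimately show ?thesis
    by (simp add: Psi_fun_scaleC Psi_fun_diff Psi_extend_EF)
qed

end

text \<open>Up to words that \<open>next_level\<close> disposes of, \<open>f\<close> is a finite sum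
  of functions \<open>extend\<close>, one for each exponent gamma of size k - i with gamma_1 = p,
  and \<open>Psi_extend\<close> kills each of them.\<close>

lemma components_vanish_from_step: "components_vanish_from u k i p T"
  unfolding components_vanish_from_def
proof (intro allI impI)
  fix f :: "gen list \<Rightarrow> 'w \<Rightarrow> 'u"
  assume f: "test_fun f" and low: "\<forall>zs v. length zs = k \<longrightarrow>
      length (odds zs) < i \<or> length (odds zs) = i \<and> count (mset (evens zs)) 1 < p \<longrightarrow> f zs v = 0"
  define \<Gamma> where "\<Gamma> = {\<gamma> :: 4 multiset. size \<gamma> = k - i \<and> count \<gamma> 1 = p}"
  have "finite {xs :: 4 list. length xs = k - i}"
    using finite_lists_length_eq[of "UNIV :: 4 set" "k - i"] by simp
  moreover have "\<Gamma> \<subseteq> mset ` {xs :: 4 list. length xs = k - i}"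
  proof
    fix \<gamma> assume "\<gamma> \<in> \<Gamma>"
    moreover obtain xs where "mset xs = \<gamma>" using ex_mset by blast
    ultimately show "\<gamma> \<in> mset ` {xs. length xs = k - i}"
      by (auto simp: \<Gamma>_def)
  qed
  ultimately have fin: "finite \<Gamma>"
    using finite_surj by blast
  \<comment> \<open>Any ordering of gamma will do, since even letters commute in a test
    function.\<close>
  define lst where "lst = (\<lambda>\<gamma>. SOME xs :: 4 list. mset xs = \<gamma>)"
  have lst: "mset (lst \<gamma>) = \<gamma>" for \<gamma>
    unfolding lst_def by (rule someI_ex) (rule ex_mset)
  \<comment> \<open>The cutoff at length \<open>i\<close> supplies the support condition
    \<open>F_supp\<close>.\<close>
  define F where "F \<gamma> = (\<lambda>l v. if length l = i then f (map Partial (lst \<gamma>) @ l) v else 0)" for \<gamma>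
  have F: "test_fun (F \<gamma>)" for \<gamma>
    unfolding F_def by (rule test_fun_length) (rule test_fun_append[OF f])
  have "Psi f u = Psi (\<lambda>l v. \<Sum>\<gamma>\<in>\<Gamma>. extend \<gamma> (F \<gamma>) l v) u"
  proof (rule Psi_eqI[OF f test_fun_sum[OF test_fun_extend[OF F]]])
    show "f zs v = (\<Sum>\<gamma>\<in>\<Gamma>. extend \<gamma> (F \<gamma>) zs v)" if "length zs = k" "length (odds zs) < i" for zs v
    proof -
      have "mset (evens zs) \<notin> \<Gamma>"
        using length_evens_odds[of zs] that ik by (auto simp: \<Gamma>_def)
      then have "(\<Sum>\<gamma>\<in>\<Gamma>. extend \<gamma> (F \<gamma>) zs v) = 0"
        by (intro sum.neutral) (auto simp: extend_def)
      then show ?thesis using low that by simp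
    qed
    show "f zs v = (\<Sum>\<gamma>\<in>\<Gamma>. extend \<gamma> (F \<gamma>) zs v)"
      if "length zs = k" "length (odds zs) = i" "count (mset (evens zs)) 1 \<le> p" for zs v
    proof -
      let ?\<gamma> = "mset (evens zs)"
      have sum: "(\<Sum>\<gamma>\<in>\<Gamma>. extend \<gamma> (F \<gamma>) zs v) = (if ?\<gamma> \<in> \<Gamma> then F ?\<gamma> (map Dform (odds zs)) v else 0)"
        using fin by (simp add: extend_def)
      show ?thesis
      proof (cases "count ?\<gamma> 1 < p")
        case True
        then have "?\<gamma> \<notin> \<Gamma>" by (simp add: \<Gamma>_def)
        then show ?thesis using low that True sum by simp
      next
        case False
        then have "?\<gamma> \<in> \<Gamma>"
          using that length_evens_odds[of zs] by (simp add: \<Gamma>_def)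
        moreover have "f zs v = f (map Partial (lst ?\<gamma>) @ map Dform (odds zs)) v"
          using test_fun_reorder[OF f, of zs v] test_fun_permute_evens[OF f, of "lst ?\<gamma>"
              "evens zs"] lst by simp
        ultimately show ?thesis
          using sum that by (simp add: F_def)
      qed
    qed
  qed
  also have "\<dots> = (\<Sum>\<gamma>\<in>\<Gamma>. Psi (extend \<gamma> (F \<gamma>)) u)"
    by (rule Psi_fun_sum)
  also have "\<dots> = 0"
  proof (intro sum.neutral ballI Psi_extend F)
    show "F \<gamma> zs v = 0" if "evens zs = []" "length (odds zs) \<noteq> i" for \<gamma> zs v
      using that length_evens_odds[of zs] by (simp add: F_def)
  qed (simp_all add: \<Gamma>_def)
  finally show "Psi f u = 0" .
qed

end

text \<open>The outer induction lowers the number of factors d_j from 5, where the claim is the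
  pigeonhole lemma, to 0; the inner one lowers the exponent of partial_1.\<close>

lemma Verma_singular_null:
  assumes u: "u \<in> Verma_degree W k" and k: "6 \<le> k"
    and singular: "\<And>x. x \<in> L_ge 1 \<Longrightarrow> act (Verma W) x u \<in> null_sp (Verma W)"
  shows "u \<in> null_sp (Verma W)"
proof -
  let ?T = "TYPE((e44 list \<times> 'w) \<Rightarrow>\<^sub>0 complex)"
  have "components_vanish_from u k (5 - j) 0 ?T" if "j \<le> 5" for j
    using that
  proof (induction j)
    case 0
    show ?case
      unfolding components_vanish_from_def
    proof (intro allI impI)
      fix f :: "gen list \<Rightarrow> 'w \<Rightarrow> ((e44 list \<times> 'w) \<Rightarrow>\<^sub>0 complex)"
      assume f: "test_fun f" and low: "\<forall>zs v. length zs = k \<longrightarrow> length (odds zs) < 5 - 0 \<or>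
        length (odds zs) = 5 - 0 \<and> count (mset (evens zs)) 1 < 0 \<longrightarrow> f zs v = 0"
      have "f zs v = 0" if "length zs = k" for zs v
        using low that test_fun_many_odd[OF f, of zs v] by (cases "length (odds zs) < 5") simp_all
      then show "Psi f u = 0"
        by (rule Psi_vanish[OF u f])
    qed
  next
    case (Suc j)
    let ?i = "5 - Suc j"
    \<comment> \<open>Here \<open>6 <= k\<close> is used: at most four factors d_j leave at least
      two partial derivatives.\<close>
    have i: "5 - j = Suc ?i" "?i + 2 \<le> k"
      using Suc.prems k by simp_all
    \<comment> \<open>No word of length k reaches the exponent k + 1, so starting the inner
      induction there restates the end of the previous outer step.\<close>
    have "count (mset (evens zs)) 1 < Suc k" if "length zs = k" for zs
      using count_le_size[of "mset (evens zs)" 1] length_evens_odds[of zs] that by simp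
    then have "components_vanish_from u k ?i (Suc k) ?T"
      using Suc.IH Suc.prems unfolding i(1) components_vanish_from_def less_Suc_eq by simp
    then have "components_vanish_from u k ?i (Suc k - n) ?T" for n
    proof (induction n)
      case (Suc n)
      show ?case
      proof (cases "n \<le> k")
        case True
        then have "Suc k - n = Suc (Suc k - Suc n)" by simp
        then show ?thesis
          using Suc components_vanish_from_step[OF singular i(2), of "Suc k - Suc n" ?T] by simp
      next
        case False
        then show ?thesis using Suc by simp
      qed
    qed simp
    from this[of "Suc k"] show ?case by simp
  qed
  from this[of 5] have "components_vanish_from u k 0 0 ?T" by simp
  then have "Psi f u = 0" if "test_fun f" for f :: "gen list \<Rightarrow> 'w \<Rightarrow> ((e44 list \<times> 'w) \<Rightarrow>\<^sub>0 complex)"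
    using that unfolding components_vanish_from_def by simp
  then show ?thesis
    by (rule Psi_separates[OF u])
qed

end

theorem proposition5p5:
  fixes t :: complex and a b c k :: nat
    and W :: "('w::complex_vec) supermod"
    and w :: "(e44 list \<times> 'w) \<Rightarrow>\<^sub>0 complex"
  assumes "is_W t a b c W"
    and "L_pos_trivial W"
    and "singular_of_degree W k w"
  shows "k \<le> 5"
proof (rule ccontr)
  assume "\<not> k \<le> 5"
  have W: "supermodule (L_ge 0) W"
    using assms(2) by (simp add: L_pos_trivial_def)
  note W_axioms = W[unfolded supermodule_def]
  have parts: "cvec.subspace (part W p)" for p
    using W_axioms by (elim conjE) (erule spec)
  have carrier: "cvec.subspace (carrier_sp W)"
    unfolding carrier_sp_def by (rule cvec.subspace_sums[OF parts parts])
  have null: "cvec.subspace (null_sp W)" "null_sp W \<subseteq> carrier_sp W"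
    by (rule W_axioms[THEN conjunct2, THEN conjunct1] W_axioms[THEN conjunct2, THEN conjunct2,
        THEN conjunct1])+
  \<comment> \<open>A linear section of the quotient defining W, on the whole type, makes the dual
    pairing available.\<close>
  obtain g where g: "additive_scaleC g" "\<forall>v. g v \<in> carrier_sp W"
    "\<forall>v\<in>carrier_sp W. g v - v \<in> null_sp W" "\<forall>v\<in>null_sp W. g v = 0"
    using quotient_projection[OF null(1) carrier null(2)] by (elim exE conjE) (rule that)
  interpret module_projection W g
    by unfold_locales (use W g in auto)
  have "w \<in> null_sp (Verma W)"
    using Verma_singular_null[of w k] assms(3) \<open>\<not> k \<le> 5\<close> unfolding singular_of_degree_def by simp
  then show False
    using assms(3) by (simp add: singular_of_degree_def)
qed

end
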